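(* Let $P_{(1,1,0,0)}$ be the set of all cylindric partitions with profile $c=(1,1,0,0)$. Then, as formal power series in $q$, $$\sum_{\Lambda\in P_{(1,1,0,0)}} q^{|\Lambda|}=\left(\sum_{n\ge0}\frac{q^{n^2}}{(q^2;q^2)_n}\right)\frac{(-q^2;q^2)_\infty}{(q;q)_\infty}.$$
   Context: Let $r,\ell$ be positive integers and $c=(c_1,\dots,c_r)$ a composition of $\ell$ into $r$ nonnegative integer parts (zero entries allowed). A cylindric partition with profile $c$ is a tuple $\Lambda=(\lambda^{(1)},\dots,\lambda^{(r)})$ of ordinary partitions $\lambda^{(i)}=(\lambda^{(i)}_1\ge\lambda^{(i)}_2\ge\cdots)$ (parts beyond the length are taken to be $0$) such that for all $i,j$: $\lambda^{(i)}_j\ge\lambda^{(i+1)}_{j+c_{i+1}}$ for $1\le i\le r-1$, and $\lambda^{(r)}_j\ge\lambda^{(1)}_{j+c_1}$. The size $|\Lambda|$ is the sum of all parts of all $\lambda^{(i)}$; the empty cylindric partition is included with size $0$. Notation: $(a;q)_n=\prod_{k=1}^n(1-aq^{k-1})$, $(a;q)_\infty=\lim_{n\to\infty}(a;q)_n$. *)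

theory Defs
  imports "HOL-Analysis.Infinite_Sum" "HOL-Computational_Algebra.Formal_Power_Series"
begin

text \<open>Partitions are weakly decreasing lists of positive naturals. Parts are indexed from 0, and parts
beyond the length are 0.\<close>

definition is_partition :: "nat list \<Rightarrow> bool" where
  "is_partition xs \<longleftrightarrow> sorted_wrt (\<ge>) xs \<and> 0 \<notin> set xs"

definition part :: "nat list \<Rightarrow> nat \<Rightarrow> nat" where
  "part xs j = (if j < length xs then xs ! j else 0)"

text \<open>Here \<open>\<Lambda> ! i\<close> and \<open>c ! i\<close> stand for the \<open>(i + 1)\<close>-st partition and the \<open>(i + 1)\<close>-st entry of the profile,
so \<open>r - 1\<close> and \<open>0\<close> are the last and the first index. The definition is meant for nonempty \<open>c\<close>.\<close>

definition cylindric_partitions :: "nat list \<Rightarrow> nat list list set" where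
  "cylindric_partitions c = {\<Lambda>. let r = length c in
     length \<Lambda> = r \<and> (\<forall>i<r. is_partition (\<Lambda> ! i)) \<and>
     (\<forall>i j. i + 1 < r \<longrightarrow> part (\<Lambda> ! i) j \<ge> part (\<Lambda> ! (i + 1)) (j + c ! (i + 1))) \<and>
     (\<forall>j. part (\<Lambda> ! (r - 1)) j \<ge> part (\<Lambda> ! 0) (j + c ! 0))}"

definition cyl_size :: "nat list list \<Rightarrow> nat" where
  "cyl_size \<Lambda> = sum_list (map sum_list \<Lambda>)"

definition qpoch :: "'a::comm_ring_1 \<Rightarrow> 'a \<Rightarrow> nat \<Rightarrow> 'a" where
  "qpoch a q n = (\<Prod>k=1..n. 1 - a * q ^ (k - 1))"

text \<open>For formal power series the limit is taken in the library's metric, that is, coefficientwise with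
each coefficient eventually constant.\<close>

definition qpoch_inf :: "'a::field fps \<Rightarrow> 'a fps \<Rightarrow> 'a fps" where
  "qpoch_inf a q = lim (qpoch a q)"

end

theory Submission
  imports Defs
begin

text \<open>By Euler, \<open>\<Sum>n. q ^ (n\<^sup>2) / (q\<^sup>2; q\<^sup>2)\<^sub>n = (- q; q\<^sup>2)\<^sub>\<infinity>\<close>, so the right-hand side is
\<open>(q\<^sup>2; q\<^sup>2)\<^sub>\<infinity> / (q; q)\<^sub>\<infinity>\<^sup>2\<close>. On the other side, the cells of a cylindric partition of profile \<open>(1, 1, 0, 0)\<close>
split into two chains (level-rank duality), which turns it into a pair of partitions \<open>x\<close>, \<open>y\<close> with
\<open>y\<^sub>j\<^sub>+\<^sub>1 \<le> x\<^sub>j\<close> and \<open>x\<^sub>j\<^sub>+\<^sub>3 \<le> y\<^sub>j\<close>. Let \<open>f m n\<close> be the generating function of the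
pairs with at most \<open>m\<close> and \<open>n\<close> parts. Subtracting 1 from all parts gives
\<open>(1 - q ^ (m + n)) * f m n = f (m - 1) n + f m (n - 1) - f (m - 1) (n - 1)\<close>, and the inequalities give
the boundary conditions \<open>f m (m + 2) = f m (m + 1)\<close> and \<open>f (n + 4) n = f (n + 3) n\<close>. As the
recurrence depends on \<open>m + n\<close> only, every \<open>1 / ((q; q)\<^sub>m\<^sub>+\<^sub>k (q; q)\<^sub>n\<^sub>-\<^sub>k)\<close> solves it, and the method of images
selects the alternating combination that satisfies the boundary conditions. For \<open>m = n \<rightarrow> \<infinity>\<close> it becomes
\<open>\<Sum>i\<in>\<int>. (- 1) ^ i * q ^ (3 * i\<^sup>2 + i)\<close> divided by \<open>(q; q)\<^sub>\<infinity>\<^sup>2\<close>, and the sum is \<open>(q\<^sup>2; q\<^sup>2)\<^sub>\<infinity>\<close> by the pentagonal number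
theorem.\<close>

unbundle fps_syntax

subsection \<open>Congruence modulo powers of the variable\<close>

text \<open>Agreement of the coefficients below \<open>n\<close>, written as a divisibility so that
  the rules for sums and products come from those for \<open>dvd\<close>. Limits and infinite
  products are compared through it.\<close>

definition fps_cong :: "nat \<Rightarrow> 'a::comm_ring_1 fps \<Rightarrow> 'a fps \<Rightarrow> bool" where
  "fps_cong n f g \<longleftrightarrow> fps_X ^ n dvd f - g"

lemma fps_cong_refl [simp]: "fps_cong n f f"
  by (simp add: fps_cong_def)

lemma fps_cong_sym: "fps_cong n f g \<Longrightarrow> fps_cong n g f"
  unfolding fps_cong_def by (subst dvd_minus_iff[symmetric]) simp

lemma fps_cong_trans: "fps_cong n f g \<Longrightarrow> fps_cong n g h \<Longrightarrow> fps_cong n f h"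
  unfolding fps_cong_def by (drule (1) dvd_add) simp

lemma fps_cong_mono: "fps_cong n f g \<Longrightarrow> m \<le> n \<Longrightarrow> fps_cong m f g"
  unfolding fps_cong_def by (rule dvd_trans[OF le_imp_power_dvd])

lemma fps_cong_mult:
  assumes "fps_cong n f g" "fps_cong n f' g'"
  shows "fps_cong n (f * f') (g * g')"
proof -
  have "f * f' - g * g' = (f - g) * f' + g * (f' - g')"
    by (simp add: algebra_simps)
  then show ?thesis
    using assms unfolding fps_cong_def by simp
qed

lemma fps_cong_diff:
  assumes "fps_cong n f g" "fps_cong n f' g'"
  shows "fps_cong n (f - f') (g - g')"
proof -
  have *: "(f - f') - (g - g') = (f - g) - (f' - g')"
    by (simp add: algebra_simps)
  show ?thesis
    using assms unfolding fps_cong_def * by (rule dvd_diff)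
qed

lemma fps_cong_sum:
  "(\<And>i. i \<in> I \<Longrightarrow> fps_cong n (f i) (g i)) \<Longrightarrow> fps_cong n (sum f I) (sum g I)"
  unfolding fps_cong_def by (simp add: dvd_sum flip: sum_subtractf)

text \<open>The factor \<open>fps_X ^ k\<close> raises the precision by \<open>k\<close>;
  \<open>fps_cong_reflected_sum\<close> relies on this.\<close>

lemma fps_cong_X_power_mult: 
  assumes "fps_cong m f g" "n \<le> k + m"
  shows "fps_cong n (fps_X ^ k * f) (fps_X ^ k * g)"
proof -
  have "fps_X ^ (k + m) dvd fps_X ^ k * (f - g)"
    using assms(1) unfolding fps_cong_def power_add by (intro mult_dvd_mono) auto
  then have "fps_X ^ n dvd fps_X ^ k * (f - g)"
    by (rule dvd_trans[OF le_imp_power_dvd[OF assms(2)]])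
  then show ?thesis
    by (simp only: fps_cong_def right_diff_distrib)
qed

lemma fps_cong_iff_nth: "fps_cong n f g \<longleftrightarrow> (\<forall>k<n. f $ k = g $ k)"
proof
  assume "fps_cong n f g"
  then obtain h where "f - g = fps_X ^ n * h"
    by (auto simp: fps_cong_def)
  then have "(f - g) $ k = 0" if "k < n" for k
    using that by (simp add: fps_X_power_mult_nth)
  then show "\<forall>k<n. f $ k = g $ k" by simp
next
  assume *: "\<forall>k<n. f $ k = g $ k"
  have "f - g = fps_X ^ n * fps_shift n (f - g)"
    using * by (auto simp: fps_eq_iff fps_X_power_mult_nth)
  then show "fps_cong n f g"
    unfolding fps_cong_def by (metis dvd_triv_left)
qed

lemma fps_eqI_cong: "(\<And>n. fps_cong n f g) \<Longrightarrow> f = g"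
  by (auto simp: fps_cong_iff_nth fps_eq_iff)

lemma fps_tendsto_if_cong:
  assumes "\<And>n. fps_cong n (f n) g"
  shows "f \<longlonglongrightarrow> g"
proof (rule tendsto_fpsI)
  fix k
  show "\<forall>\<^sub>F n in sequentially. f n $ k = g $ k"
    using eventually_gt_at_top[of k]
    by eventually_elim (use assms in \<open>auto simp: fps_cong_iff_nth\<close>)
qed

lemma fps_cong_lim:
  assumes "\<And>n. fps_cong n (f (Suc n)) (f n)"
  shows "f \<longlonglongrightarrow> lim f" "fps_cong n (f n) (lim f)"
proof -
  \<comment> \<open>Coefficient \<open>k\<close> is constant from index \<open>k + 1\<close> on, so
    this diagonal is the limit.\<close>
  define g where "g = Abs_fps (\<lambda>k. f (Suc k) $ k)"
  have step: "fps_cong n (f (n + d)) (f n)" for n d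
  proof (induction d)
    case (Suc d)
    show ?case
      using fps_cong_trans[OF fps_cong_mono[OF assms[of "n + d"]] Suc] by simp
  qed simp
  have g: "fps_cong n (f n) g" for n
    unfolding fps_cong_iff_nth
  proof (intro allI impI)
    fix k assume "k < n"
    then have "fps_cong (Suc k) (f n) (f (Suc k))"
      using step[of "Suc k" "n - Suc k"] by simp
    then show "f n $ k = g $ k"
      by (simp add: fps_cong_iff_nth g_def)
  qed
  have "f \<longlonglongrightarrow> g"
    by (rule fps_tendsto_if_cong) (rule g)
  moreover from this have "lim f = g"
    by (rule limI)
  ultimately show "f \<longlonglongrightarrow> lim f" "fps_cong n (f n) (lim f)"
    using g by auto
qed

subsection \<open>q-Pochhammer products\<close>

lemma qpoch_0 [simp]: "qpoch a b 0 = 1"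
  by (simp add: qpoch_def)

lemma qpoch_Suc: "qpoch a b (Suc n) = qpoch a b n * (1 - a * b ^ n)"
  by (simp add: qpoch_def)

lemma fps_cong_qpoch_inf:
  assumes "fps_X dvd a" "fps_X dvd b"
  shows "fps_cong n (qpoch a b n) (qpoch_inf a b)"
  unfolding qpoch_inf_def
proof (rule fps_cong_lim(2))
  fix n
  have "fps_X * fps_X ^ n dvd a * b ^ n"
    using assms by (intro mult_dvd_mono dvd_power_same)
  then have "fps_X ^ n dvd a * b ^ n"
    by (meson dvd_mult_right)
  then show "fps_cong n (qpoch a b (Suc n)) (qpoch a b n)"
    by (simp add: fps_cong_def qpoch_Suc right_diff_distrib)
qed

lemma qpoch_nth_0 [simp]:
  assumes "fps_X dvd (a :: 'a::field fps)"
  shows "qpoch a b n $ 0 = 1"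
proof -
  have "a $ 0 = 0"
    using assms by (auto simp: dvd_def)
  then show ?thesis
    by (induction n) (simp_all add: qpoch_Suc)
qed

lemma qpoch_inf_nth_0:
  assumes "fps_X dvd (a :: 'a::field fps)" "fps_X dvd b"
  shows "qpoch_inf a b $ 0 = 1"
  using fps_cong_qpoch_inf[OF assms, of 1] assms by (simp add: fps_cong_iff_nth)

section \<open>Euler's identity and the product side\<close>

text \<open>The first two products are the odd and the even half of the product of
  \<open>1 + q ^ k\<close> over \<open>k = 1..2 * n\<close>; each factor meets
  \<open>1 - q ^ k\<close> and gives \<open>1 - q ^ (2 * k)\<close>.\<close>

lemma qpoch_odd_even_recombine:
  fixes q :: "'a::comm_ring_1"
  shows "qpoch (- q) (q\<^sup>2) n * qpoch (- (q\<^sup>2)) (q\<^sup>2) n * qpoch q q (2 * n)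
       = qpoch (q\<^sup>2) (q\<^sup>2) (2 * n)"
proof (induction n)
  case (Suc n)
  have e: "2 * Suc n = Suc (Suc (2 * n))" by simp
  define u v where "u = q * (q\<^sup>2) ^ n" and "v = q\<^sup>2 * (q\<^sup>2) ^ n"
  have uv: "q * q ^ (2 * n) = u" "q * q ^ Suc (2 * n) = v" "- q * (q\<^sup>2) ^ n = - u" "- (q\<^sup>2) * (q\<^sup>2) ^ n = - v"
    "q\<^sup>2 * (q\<^sup>2) ^ (2 * n) = u * u" "q\<^sup>2 * (q\<^sup>2) ^ Suc (2 * n) = v * v"
    by (simp_all add: u_def v_def power_mult power2_eq_square power_mult_distrib mult_ac)
  have *: "(1 - - q * (q\<^sup>2) ^ n) * (1 - - (q\<^sup>2) * (q\<^sup>2) ^ n)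
         * ((1 - q * q ^ (2 * n)) * (1 - q * q ^ Suc (2 * n)))
       = (1 - q\<^sup>2 * (q\<^sup>2) ^ (2 * n)) * (1 - q\<^sup>2 * (q\<^sup>2) ^ Suc (2 * n))"
    unfolding uv by (simp add: algebra_simps)
  have "qpoch (- q) (q\<^sup>2) (Suc n) * qpoch (- (q\<^sup>2)) (q\<^sup>2) (Suc n) * qpoch q q (2 * Suc n)
      = (qpoch (- q) (q\<^sup>2) n * qpoch (- (q\<^sup>2)) (q\<^sup>2) n * qpoch q q (2 * n))
        * ((1 - - q * (q\<^sup>2) ^ n) * (1 - - (q\<^sup>2) * (q\<^sup>2) ^ n)
         * ((1 - q * q ^ (2 * n)) * (1 - q * q ^ Suc (2 * n))))"
    unfolding e qpoch_Suc by (simp only: mult_ac)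
  then show ?case
    unfolding * Suc e qpoch_Suc by (simp only: mult.assoc)
qed simp

text \<open>The partial sums \<open>S N = (\<Sum>n<K. q ^ (n\<^sup>2 + 2 * N * n) / (q\<^sup>2; q\<^sup>2)\<^sub>n)\<close> satisfy
\<open>S N = (1 + q ^ (2 * N + 1)) * S (N + 1)\<close> up to high powers of \<open>q\<close>, and iterating this from \<open>N = 0\<close>
produces the product.\<close>

lemma euler_partial_sum_cong:
  fixes q :: "'a::field fps"
  defines "q \<equiv> fps_X"
  shows "fps_cong K (\<Sum>n<K. q ^ (n\<^sup>2) / qpoch (q\<^sup>2) (q\<^sup>2) n) (qpoch (- q) (q\<^sup>2) K)"
proof (cases K)
  case 0
  then show ?thesis by (simp add: fps_cong_def)
next
  case (Suc M)
  define w where "w n = inverse (qpoch (q\<^sup>2) (q\<^sup>2) n)" for n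
  define S where "S N = (\<Sum>n<K. q ^ (n\<^sup>2 + 2 * N * n) * w n)" for N
  have unit: "qpoch (q\<^sup>2) (q\<^sup>2) n $ 0 = 1" for n
    by (simp add: q_def)
  have w: "(1 - q ^ (2 * Suc n)) * w (Suc n) = w n" for n
  proof -
    have *: "qpoch (q\<^sup>2) (q\<^sup>2) n * w n = 1" "qpoch (q\<^sup>2) (q\<^sup>2) (Suc n) * w (Suc n) = 1"
      by (simp_all add: w_def mult.commute[of _ "inverse _"] inverse_mult_eq_1 unit)
    have "q ^ (2 * Suc n) = q\<^sup>2 * (q\<^sup>2) ^ n"
      by (simp only: power_mult power_Suc)
    then have "w n * (qpoch (q\<^sup>2) (q\<^sup>2) (Suc n) * w (Suc n))
        = (qpoch (q\<^sup>2) (q\<^sup>2) n * w n) * ((1 - q ^ (2 * Suc n)) * w (Suc n))"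
      by (simp only: qpoch_Suc mult_ac)
    with * show ?thesis by simp
  qed
  have step: "fps_cong K (S N) ((1 + q * (q\<^sup>2) ^ N) * S (Suc N))" for N
  proof -
    have "S N - S (Suc N) = (\<Sum>n<K. q ^ (n\<^sup>2 + 2 * N * n) * ((1 - q ^ (2 * n)) * w n))"
      unfolding S_def by (simp add: algebra_simps power_add flip: sum_subtractf)
    also have "\<dots> = (\<Sum>n<M. q ^ ((Suc n)\<^sup>2 + 2 * N * Suc n) * w n)"
      unfolding Suc sum.lessThan_Suc_shift w by simp
    also have "\<dots> = q * (q\<^sup>2) ^ N * (\<Sum>n<M. q ^ (n\<^sup>2 + 2 * Suc N * n) * w n)"
    proof -
      have "q ^ ((Suc n)\<^sup>2 + 2 * N * Suc n) = q * (q\<^sup>2) ^ N * q ^ (n\<^sup>2 + 2 * Suc N * n)" for n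
        unfolding power_mult[symmetric] power_Suc[symmetric] power_add[symmetric]
        by (rule arg_cong[of _ _ "(^) q"]) (simp add: power2_eq_square algebra_simps)
      then show ?thesis
        by (simp only: sum_distrib_left mult.assoc)
    qed
    \<comment> \<open>\<open>S (Suc N)\<close> has one term more than the sum over
      \<open>n<M\<close>. That term, \<open>n = M\<close>, is the whole error; with the factor in
      front its exponent is at least \<open>Suc M = K\<close>.\<close>
    finally have "S N - (1 + q * (q\<^sup>2) ^ N) * S (Suc N)
        = - (q * (q\<^sup>2) ^ N) * (q ^ (M\<^sup>2 + 2 * Suc N * M) * w M)"
      unfolding S_def Suc by (simp add: algebra_simps)
    also have "\<dots> = q ^ Suc (M + (M\<^sup>2 + (2 * N + 1) * M + 2 * N)) * (- w M)"
    proof -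
      have "q ^ Suc (M + (M\<^sup>2 + (2 * N + 1) * M + 2 * N)) = q * (q\<^sup>2) ^ N * q ^ (M\<^sup>2 + 2 * Suc N * M)"
        unfolding power_mult[symmetric] power_Suc[symmetric] power_add[symmetric]
        by (rule arg_cong[of _ _ "(^) q"]) (simp add: algebra_simps)
      then show ?thesis
        by (simp only: mult.assoc mult_minus_left mult_minus_right)
    qed
    finally show ?thesis
      unfolding fps_cong_def Suc q_def
      by (metis add_Suc dvd_mult2 dvd_triv_left power_add)
  qed
  have iter: "fps_cong K (S 0) (qpoch (- q) (q\<^sup>2) N * S N)" for N
  proof (induction N)
    case (Suc N)
    show ?case
      using fps_cong_trans[OF Suc fps_cong_mult[OF fps_cong_refl step]]
      by (simp add: qpoch_Suc mult.assoc)
  qed simp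
  \<comment> \<open>For \<open>N = K\<close> every term except that of \<open>n = 0\<close> contains
    \<open>q ^ (2 * K * n)\<close>.\<close>
  have "fps_cong K (S K) 1"
  proof -
    have "S K - 1 = (\<Sum>n<M. q ^ ((Suc n)\<^sup>2 + 2 * K * Suc n) * w (Suc n))"
      unfolding S_def Suc sum.lessThan_Suc_shift by (simp add: w_def)
    also have "q ^ K dvd \<dots>"
      by (intro dvd_sum dvd_mult2 le_imp_power_dvd) simp
    finally show ?thesis by (simp add: fps_cong_def q_def)
  qed
  then have "fps_cong K (S 0) (qpoch (- q) (q\<^sup>2) K)"
    using fps_cong_trans[OF iter fps_cong_mult[OF fps_cong_refl]] by fastforce
  then show ?thesis
    by (simp add: S_def w_def fps_divide_unit unit)
qed

lemma euler_odd_product: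
  fixes q :: "'a::field fps"
  defines "q \<equiv> fps_X"
  shows "fps_cong K (\<Sum>n. q ^ (n\<^sup>2) / qpoch (q\<^sup>2) (q\<^sup>2) n) (qpoch (- q) (q\<^sup>2) K)"
proof -
  let ?u = "\<lambda>n. q ^ (n\<^sup>2) / qpoch (q\<^sup>2) (q\<^sup>2) n"
  have c: "fps_cong n (\<Sum>i<Suc n. ?u i) (\<Sum>i<n. ?u i)" for n
  proof -
    have "q ^ n dvd q ^ (n\<^sup>2) * inverse (qpoch (q\<^sup>2) (q\<^sup>2) n)"
      by (intro dvd_mult2 le_imp_power_dvd) (simp add: power2_eq_square)
    then have "q ^ n dvd ?u n"
      by (simp add: fps_divide_unit q_def)
    then show ?thesis by (simp add: fps_cong_def q_def)
  qed
  have "?u sums lim (\<lambda>n. \<Sum>i<n. ?u i)"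
    unfolding sums_def using fps_cong_lim(1)[of "\<lambda>n. \<Sum>i<n. ?u i", OF c] .
  then have "suminf ?u = lim (\<lambda>n. \<Sum>i<n. ?u i)"
    by (rule sums_unique[symmetric])
  then have "fps_cong K (suminf ?u) (\<Sum>i<K. ?u i)"
    using fps_cong_lim(2)[of "\<lambda>n. \<Sum>i<n. ?u i", OF c] by (simp add: fps_cong_sym)
  then show ?thesis
    using euler_partial_sum_cong[of K, where ?'a='a] fps_cong_trans unfolding q_def by blast
qed

text \<open>Clearing the denominator leaves an identity of products: modulo \<open>q ^ K\<close> the
  series is \<open>qpoch (- q) (q\<^sup>2) K\<close> by Euler, and
  \<open>qpoch_odd_even_recombine\<close> does the rest.\<close>

lemma product_side:
  fixes q :: "'a::field fps"
  defines "q \<equiv> fps_X"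
  shows "(\<Sum>n. q ^ (n\<^sup>2) / qpoch (q\<^sup>2) (q\<^sup>2) n) * qpoch_inf (- (q\<^sup>2)) (q\<^sup>2) * qpoch_inf q q
       = qpoch_inf (q\<^sup>2) (q\<^sup>2)" (is "?E * ?D * ?P = ?Q")
proof (rule fps_eqI_cong)
  fix K
  have "fps_cong K (qpoch (- (q\<^sup>2)) (q\<^sup>2) K) ?D"
    by (rule fps_cong_qpoch_inf) (simp_all add: q_def)
  moreover have "fps_cong (2 * K) (qpoch q q (2 * K)) ?P" "fps_cong (2 * K) (qpoch (q\<^sup>2) (q\<^sup>2) (2 * K)) ?Q"
    by (rule fps_cong_qpoch_inf; simp add: q_def)+
  then have "fps_cong K (qpoch q q (2 * K)) ?P" "fps_cong K (qpoch (q\<^sup>2) (q\<^sup>2) (2 * K)) ?Q"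
    by (auto elim: fps_cong_mono)
  ultimately have "fps_cong K (?E * ?D * ?P) (qpoch (q\<^sup>2) (q\<^sup>2) (2 * K))"
    unfolding qpoch_odd_even_recombine[symmetric]
    by (intro fps_cong_mult euler_odd_product[where ?'a='a, folded q_def]) (simp_all add: fps_cong_sym)
  with \<open>fps_cong K (qpoch (q\<^sup>2) (q\<^sup>2) (2 * K)) ?Q\<close> show "fps_cong K (?E * ?D * ?P) ?Q"
    by (rule fps_cong_trans[rotated])
qed

subsection \<open>The method of images\<close>

text \<open>With the value 0 at negative \<open>k\<close>, \<open>inv_qfact_pred\<close> holds for
  all integers: for \<open>k \<le> 0\<close> its factor \<open>1 - fps_X ^ 0\<close>
  vanishes.\<close>

definition inv_qfact :: "int \<Rightarrow> 'a::field fps" where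
  "inv_qfact k = (if k < 0 then 0 else inverse (qpoch fps_X fps_X (nat k)))"

lemma inv_qfact_0 [simp]: "inv_qfact 0 = 1"
  by (simp add: inv_qfact_def)

lemma inv_qfact_neg [simp]: "k < 0 \<Longrightarrow> inv_qfact k = 0"
  by (simp add: inv_qfact_def)

lemma inv_qfact_mult_zero: "a < 0 \<or> b < 0 \<Longrightarrow> inv_qfact a * inv_qfact b = 0"
  by auto

lemma inv_qfact_pred: "inv_qfact (k - 1) = (1 - fps_X ^ nat k) * inv_qfact k"
proof (cases "k > 0")
  case True
  define n where "n = nat (k - 1)"
  have k: "k = int (Suc n)"
    using True by (simp add: n_def)
  let ?p = "qpoch fps_X fps_X :: nat \<Rightarrow> 'a fps"
  have "inverse (?p n) = (?p n * inverse (?p n)) * ((1 - fps_X ^ Suc n) * inverse (?p (Suc n)))"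
  proof -
    have "(?p n * inverse (?p n)) * ((1 - fps_X ^ Suc n) * inverse (?p (Suc n)))
        = inverse (?p n) * (?p (Suc n) * inverse (?p (Suc n)))"
      by (simp only: qpoch_Suc power_Suc mult_ac)
    also have "?p (Suc n) * inverse (?p (Suc n)) = 1"
      by (subst mult.commute, rule inverse_mult_eq_1) simp
    finally show ?thesis by simp
  qed
  also have "?p n * inverse (?p n) = 1"
    by (subst mult.commute, rule inverse_mult_eq_1) simp
  finally show ?thesis
    by (simp add: inv_qfact_def k nat_add_distrib)
next
  case False
  then show ?thesis by (cases "k = 0") auto
qed

lemma inv_qfact_diff: "inv_qfact k - inv_qfact (k - 1) = fps_X ^ nat k * inv_qfact k"
  by (simp add: inv_qfact_pred algebra_simps)

text \<open>With \<open>x = fps_X ^ nat a\<close> and \<open>y = fps_X ^ nat b\<close> this is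
  \<open>1 - x * y = (1 - x) + (1 - y) - (1 - x) * (1 - y)\<close>; if an index is negative, both
  sides vanish.\<close>

lemma inv_qfact_mult_rec:
  "(1 - fps_X ^ nat (a + b)) * (inv_qfact a * inv_qfact b) =
   inv_qfact (a - 1) * inv_qfact b + inv_qfact a * inv_qfact (b - 1) -
   inv_qfact (a - 1) * inv_qfact (b - 1)"
proof (cases "a < 0 \<or> b < 0")
  case False
  then have "nat (a + b) = nat a + nat b"
    by (simp add: nat_add_distrib)
  then show ?thesis
    by (simp add: inv_qfact_pred power_add algebra_simps)
qed auto

lemma fps_cong_inv_qfact: "fps_cong (nat k) (inv_qfact k * qpoch_inf fps_X fps_X) (1 :: 'a::field fps)"
proof (cases "k < 0")
  case True
  then show ?thesis by (simp add: fps_cong_def)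
next
  case False
  let ?p = "qpoch fps_X fps_X (nat k) :: 'a fps"
  have "fps_cong (nat k) (inverse ?p * qpoch_inf fps_X fps_X) (inverse ?p * ?p)"
    by (intro fps_cong_mult fps_cong_refl fps_cong_sym[OF fps_cong_qpoch_inf]) auto
  moreover have "inverse ?p * ?p = 1"
    by (rule inverse_mult_eq_1) simp
  ultimately show ?thesis
    using False by (simp add: inv_qfact_def)
qed

lemma abs_le_square_int: "\<bar>j :: int\<bar> \<le> j\<^sup>2"
proof (cases "j = 0")
  case False
  then have "\<bar>j\<bar> * 1 \<le> \<bar>j\<bar> * \<bar>j\<bar>"
    by (intro mult_left_mono) auto
  then show ?thesis
    by (simp add: power2_eq_square flip: abs_mult)
qed simp

text \<open>The conditions \<open>f m (m + 2) = f m (m + 1)\<close> and \<open>f (n + 4) n = f (n + 3) n\<close> for a combination of the solutions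
\<open>inv_qfact (m + k) * inv_qfact (n - k)\<close> exchange the index \<open>k\<close> with \<open>2 - k\<close> and with \<open>- 4 - k\<close>. The orbit of \<open>k = 0\<close>
consists of the numbers \<open>6 * j\<close> and \<open>2 - 6 * j\<close>, and the two exchanges determine their coefficients.
The sum is cut off at \<open>\<bar>j\<bar> = L\<close>, which loses nothing for the \<open>m\<close>, \<open>n\<close> in question once \<open>n < 6 * L\<close>.\<close>

definition reflected_sum :: "int \<Rightarrow> int \<Rightarrow> int \<Rightarrow> 'a::field fps" where
  "reflected_sum L m n = (\<Sum>j=-L..L.
     fps_X ^ nat (12 * j\<^sup>2 + 2 * j) * (inv_qfact (m + 6 * j) * inv_qfact (n - 6 * j)) -
     fps_X ^ nat (12 * j\<^sup>2 - 10 * j + 2) * (inv_qfact (m + 2 - 6 * j) * inv_qfact (n - 2 + 6 * j)))"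

lemma reflected_sum_rec:
  "(1 - fps_X ^ nat (m + n)) * reflected_sum L m n =
   reflected_sum L (m - 1) n + reflected_sum L m (n - 1) - reflected_sum L (m - 1) (n - 1)"
proof -
  have r: "(1 - fps_X ^ nat (m + n)) * (inv_qfact (m + k) * inv_qfact (n - k)) =
     inv_qfact (m - 1 + k) * inv_qfact (n - k) + inv_qfact (m + k) * inv_qfact (n - 1 - k)
      - inv_qfact (m - 1 + k) * (inv_qfact (n - 1 - k) :: 'a fps)" for k
    using inv_qfact_mult_rec[of "m + k" "n - k"] by (simp add: algebra_simps)
  \<comment> \<open>The second family of images is the first one with \<open>k\<close> replaced by
    \<open>2 - k\<close>.\<close>
  have r': "(1 - fps_X ^ nat (m + n)) * (inv_qfact (m + 2 - k) * inv_qfact (n - 2 + k)) =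
     inv_qfact (m - 1 + 2 - k) * inv_qfact (n - 2 + k) + inv_qfact (m + 2 - k) * inv_qfact (n - 1 - 2 + k)
      - inv_qfact (m - 1 + 2 - k) * (inv_qfact (n - 1 - 2 + k) :: 'a fps)" for k
    using r[of "2 - k"] by (simp add: algebra_simps)
  have lin: "c * (x * a - y * b) = (x * a1 - y * b1) + (x * a2 - y * b2) - (x * a3 - y * b3)"
    if "c * a = a1 + a2 - a3" "c * b = b1 + b2 - b3" for c x y a b a1 a2 a3 b1 b2 b3 :: "'a fps"
  proof -
    have "c * (x * a - y * b) = x * (c * a) - y * (c * b)"
      by (simp add: algebra_simps)
    then show ?thesis
      unfolding that by (simp add: algebra_simps)
  qed
  show ?thesis
    unfolding reflected_sum_def sum_distrib_left sum.distrib[symmetric] sum_subtractf[symmetric]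
    by (intro sum.cong refl lin r r')
qed

text \<open>By \<open>inv_qfact_diff\<close> both sides are the same product times a power of
  \<open>fps_X\<close>, and the hypothesis matches the powers. This is the cancellation of a
  solution against its mirror image.\<close>

lemma inv_qfact_swap:
  assumes "d + nat a = e + nat b \<or> a < 0 \<or> b < 0"
  shows "fps_X ^ d * (inv_qfact b * (inv_qfact a - inv_qfact (a - 1)))
       = fps_X ^ e * (inv_qfact a * (inv_qfact b - inv_qfact (b - 1)))"
proof -
  have "fps_X ^ (d + nat a) * (inv_qfact b * inv_qfact a) = fps_X ^ (e + nat b) * (inv_qfact b * inv_qfact a)"
    using assms by auto
  then show ?thesis
    by (simp only: inv_qfact_diff power_add mult_ac)
qed

text \<open>On this edge the two terms of each summand are mirror images: passing from
  \<open>m + 1\<close> to \<open>m + 2\<close> changes both by the same amount.\<close>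

lemma reflected_sum_boundary1: "reflected_sum L m (m + 2) = reflected_sum L m (m + 1)"
proof -
  have *: "fps_X ^ nat (12 * j\<^sup>2 + 2 * j) * (inv_qfact (m + 6 * j) * inv_qfact (m + 2 - 6 * j)) -
     fps_X ^ nat (12 * j\<^sup>2 - 10 * j + 2) * (inv_qfact (m + 2 - 6 * j) * inv_qfact (m + 2 - 2 + 6 * j)) =
     fps_X ^ nat (12 * j\<^sup>2 + 2 * j) * (inv_qfact (m + 6 * j) * inv_qfact (m + 1 - 6 * j)) -
     fps_X ^ nat (12 * j\<^sup>2 - 10 * j + 2) * (inv_qfact (m + 2 - 6 * j) * (inv_qfact (m + 1 - 2 + 6 * j) :: 'a fps))"
    for j
  proof -
    have e: "nat (12 * j\<^sup>2 + 2 * j) + nat (m + 2 - 6 * j) = nat (12 * j\<^sup>2 - 10 * j + 2) + nat (m + 6 * j)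
        \<or> m + 2 - 6 * j < 0 \<or> m + 6 * j < 0"
      using abs_le_square_int[of j] by linarith
    have s: "m + 2 - 6 * j - 1 = m + 1 - 6 * j" "m + 6 * j - 1 = m + 1 - 2 + 6 * j" "m + 2 - 2 + 6 * j = m + 6 * j"
      by auto
    show ?thesis
      using inv_qfact_swap[OF e, where ?'a='a] unfolding s by (simp add: right_diff_distrib) (simp add: algebra_simps)
  qed
  show ?thesis
    unfolding reflected_sum_def * ..
qed

text \<open>Here the second term of index \<open>j\<close> mirrors the first term of index
  \<open>j - 1\<close>, so the difference of the two sides telescopes.\<close>

lemma reflected_sum_boundary2:
  assumes "n < 6 * L"
  shows "reflected_sum L (n + 4) n = reflected_sum L (n + 3) n"
proof (cases "L \<ge> 0")
  case True
  define D :: "int \<Rightarrow> 'a fps" where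
    "D j = fps_X ^ nat (12 * j\<^sup>2 + 2 * j) * (inv_qfact (n - 6 * j) * (inv_qfact (n + 4 + 6 * j) - inv_qfact (n + 4 + 6 * j - 1)))" for j
  have D: "D (j - 1) = fps_X ^ nat (12 * j\<^sup>2 - 10 * j + 2) *
       (inv_qfact (n - 2 + 6 * j) * (inv_qfact (n + 4 + 2 - 6 * j) - inv_qfact (n + 4 + 2 - 6 * j - 1)))" for j
  proof -
    have sq: "(j - 1)\<^sup>2 = j\<^sup>2 - 2 * j + 1"
      by (simp add: power2_eq_square algebra_simps)
    have a: "n - 6 * (j - 1) = n + 4 + 2 - 6 * j" "n + 4 + 6 * (j - 1) = n - 2 + 6 * j"
      by auto
    have e: "nat (12 * (j - 1)\<^sup>2 + 2 * (j - 1)) + nat (n - 2 + 6 * j) =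
        nat (12 * j\<^sup>2 - 10 * j + 2) + nat (n + 4 + 2 - 6 * j) \<or> n - 2 + 6 * j < 0 \<or> n + 4 + 2 - 6 * j < 0"
    proof -
      have "12 * (j - 1)\<^sup>2 + 2 * (j - 1) \<ge> 0" "12 * j\<^sup>2 - 10 * j + 2 \<ge> 0"
        using abs_le_square_int[of "j - 1"] abs_le_square_int[of j] by simp_all
      then have "nat (12 * (j - 1)\<^sup>2 + 2 * (j - 1)) + nat (n - 2 + 6 * j) =
          nat (12 * (j - 1)\<^sup>2 + 2 * (j - 1) + (n - 2 + 6 * j))"
        "nat (12 * j\<^sup>2 - 10 * j + 2) + nat (n + 4 + 2 - 6 * j) =
          nat (12 * j\<^sup>2 - 10 * j + 2 + (n + 4 + 2 - 6 * j))"
        if "n - 2 + 6 * j \<ge> 0" "n + 4 + 2 - 6 * j \<ge> 0"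
        using that by (simp_all only: nat_add_distrib)
      moreover have "12 * (j - 1)\<^sup>2 + 2 * (j - 1) + (n - 2 + 6 * j) = 12 * j\<^sup>2 - 10 * j + 2 + (n + 4 + 2 - 6 * j)"
        unfolding sq by simp
      ultimately show ?thesis
        by (cases "n - 2 + 6 * j < 0"; cases "n + 4 + 2 - 6 * j < 0") (simp_all only: not_less simp_thms)
    qed
    show ?thesis
      unfolding D_def a using inv_qfact_swap[OF e] .
  qed
  have "reflected_sum L (n + 4) n - reflected_sum L (n + 3) n = (\<Sum>j=-L..L. D j - D (j - 1))"
  proof -
    have a: "n + 4 + 6 * j - 1 = n + 3 + 6 * j" "n + 4 + 2 - 6 * j - 1 = n + 3 + 2 - 6 * j" for j
      by auto
    show ?thesis
      unfolding D unfolding D_def a reflected_sum_def sum_subtractf[symmetric]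
      by (intro sum.cong refl) (simp only: right_diff_distrib mult_ac, simp)
  qed
  also have "\<dots> = D L - D (- L - 1)"
  proof -
    have "(\<Sum>j=-int l..int l. D j - D (j - 1)) = D (int l) - D (- int l - 1)" for l
    proof (induction l)
      case (Suc l)
      have set: "{- int (Suc l)..int (Suc l)} = insert (- int (Suc l)) (insert (int (Suc l)) {- int l..int l})"
        by auto
      have e: "int (Suc l) - 1 = int l" "- int l - 1 = - int (Suc l)"
        by auto
      have "(\<Sum>j=-int (Suc l)..int (Suc l). D j - D (j - 1)) =
          (D (- int (Suc l)) - D (- int (Suc l) - 1)) +
          ((D (int (Suc l)) - D (int (Suc l) - 1)) + (\<Sum>j=-int l..int l. D j - D (j - 1)))"
        unfolding set by (subst sum.insert; simp)
      then show ?case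
        unfolding Suc e by simp
    qed simp
    from this[of "nat L"] show ?thesis using True by simp
  qed
  \<comment> \<open>\<open>D L\<close> contains \<open>inv_qfact (n - 6 * L)\<close>, and
    \<open>D (- L - 1)\<close> a difference of values of \<open>inv_qfact\<close> at
    \<open>n - 2 - 6 * L\<close> and one below; all these indices are negative.\<close>
  also have "\<dots> = 0"
    using assms by (simp add: D_def)
  finally show ?thesis by simp
qed (simp add: reflected_sum_def)

text \<open>A nonzero product needs two nonnegative indices, which confines \<open>6 * j\<close> to
  an interval without multiples of 6. The bounds 1 and 3 are those of the strip in
  \<open>reflected_sum_unique\<close> on its outermost rows.\<close>

lemma reflected_sum_neg1: "n \<le> 1 \<Longrightarrow> reflected_sum L (- 1) n = 0"
  and reflected_sum_neg2: "m \<le> 3 \<Longrightarrow> reflected_sum L m (- 1) = 0"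
proof -
  assume n: "n \<le> 1"
  have "- 1 + 6 * j < 0 \<or> n - 6 * j < 0" "- 1 + 2 - 6 * j < 0 \<or> n - 2 + 6 * j < 0" for j
    using n by presburger+
  then have "inv_qfact (- 1 + 6 * j) * inv_qfact (n - 6 * j) = (0 :: 'a fps)"
    "inv_qfact (- 1 + 2 - 6 * j) * inv_qfact (n - 2 + 6 * j) = (0 :: 'a fps)" for j
    by (simp_all only: inv_qfact_mult_zero)
  then show "reflected_sum L (- 1) n = (0 :: 'a fps)"
    unfolding reflected_sum_def by (simp only: mult_zero_right diff_self sum.neutral_const)
next
  assume m: "m \<le> 3"
  have "m + 6 * j < 0 \<or> - 1 - 6 * j < 0" "m + 2 - 6 * j < 0 \<or> - 1 - 2 + 6 * j < 0" for j
    using m by presburger+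
  then have "inv_qfact (m + 6 * j) * inv_qfact (- 1 - 6 * j) = (0 :: 'b fps)"
    "inv_qfact (m + 2 - 6 * j) * inv_qfact (- 1 - 2 + 6 * j) = (0 :: 'b fps)" for j
    by (simp_all only: inv_qfact_mult_zero)
  then show "reflected_sum L m (- 1) = (0 :: 'b fps)"
    unfolding reflected_sum_def by (simp only: mult_zero_right diff_self sum.neutral_const)
qed

lemma reflected_sum_0_0:
  assumes "L \<ge> 0"
  shows "reflected_sum L 0 0 = 1"
proof -
  have "0 + 2 - 6 * j < 0 \<or> 0 - 2 + 6 * j < 0" for j :: int
    by presburger
  then have "inv_qfact (0 + 2 - 6 * j) * inv_qfact (0 - 2 + 6 * j) = (0 :: 'a fps)" for j
    by (simp only: inv_qfact_mult_zero)
  moreover have "inv_qfact (0 + 6 * j) * inv_qfact (0 - 6 * j) = (if j = 0 then 1 else 0 :: 'a fps)" for j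
    by (auto simp: inv_qfact_def)
  ultimately have *: "reflected_sum L 0 0 = (\<Sum>j=-L..L. if j = 0 then 1 else 0 :: 'a fps)"
    unfolding reflected_sum_def by (intro sum.cong) simp_all
  show ?thesis
    unfolding * using assms by simp
qed

text \<open>Induction on \<open>m + n\<close> over the strip \<open>n \<le> m + 2\<close>,
  \<open>m \<le> n + 4\<close>: its edges descend by the boundary conditions, its interior by the
  recurrence, whose three smaller pairs stay in the strip.\<close>

lemma reflected_sum_unique:
  fixes f :: "int \<Rightarrow> int \<Rightarrow> 'a::field fps"
  assumes rec: "\<And>m n. \<lbrakk>0 \<le> m; 0 \<le> n; 0 < m + n; n \<le> m + 1; m \<le> n + 3\<rbrakk> \<Longrightarrow>
      (1 - fps_X ^ nat (m + n)) * f m n = f (m - 1) n + f m (n - 1) - f (m - 1) (n - 1)"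
    and neg: "\<And>n. f (- 1) n = 0" "\<And>m. f m (- 1) = 0"
    and zero: "f 0 0 = 1"
    and boundary1: "\<And>m. 0 \<le> m \<Longrightarrow> f m (m + 2) = f m (m + 1)"
    and boundary2: "\<And>n. 0 \<le> n \<Longrightarrow> f (n + 4) n = f (n + 3) n"
    and "- 1 \<le> m" "- 1 \<le> n" "n \<le> m + 2" "m \<le> n + 4" "n < 6 * L"
  shows "f m n = reflected_sum L m n"
  using assms(7-)
proof (induction "nat (m + n + 2)" arbitrary: m n rule: less_induct)
  case less
  have IH: "f m' n' = reflected_sum L m' n'"
    if "m' + n' < m + n" "- 1 \<le> m'" "- 1 \<le> n'" "n' \<le> m' + 2" "m' \<le> n' + 4" "n' < 6 * L" for m' n'
    by (rule less(1)) (use that in auto)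
  consider "m = - 1" | "n = - 1" | "m = 0" "n = 0" | "0 \<le> m" "n = m + 2" | "0 \<le> n" "m = n + 4"
    | "0 \<le> m" "0 \<le> n" "0 < m + n" "n \<le> m + 1" "m \<le> n + 3"
    using less.prems by linarith
  then show ?case
  proof cases
    case 1
    then show ?thesis using less.prems neg by (simp add: reflected_sum_neg1)
  next
    case 2
    then show ?thesis using less.prems neg by (simp add: reflected_sum_neg2)
  next
    case 3
    then show ?thesis using less.prems zero by (simp add: reflected_sum_0_0)
  next
    case 4
    then show ?thesis
      using boundary1[of m] IH[of m "m + 1"] less.prems by (simp add: reflected_sum_boundary1)
  next
    case 5
    then show ?thesis
      using boundary2[of n] IH[of "n + 3" n] less.prems by (simp add: reflected_sum_boundary2)
  next
    case 6
    have "(1 - fps_X ^ nat (m + n)) * f m n = (1 - fps_X ^ nat (m + n)) * reflected_sum L m n"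
      unfolding rec[OF 6] reflected_sum_rec
      using 6 less.prems by (simp add: IH)
    moreover have "1 - fps_X ^ nat (m + n) \<noteq> (0 :: 'a fps)"
    proof
      assume "1 - fps_X ^ nat (m + n) = (0 :: 'a fps)"
      then have "(1 - fps_X ^ nat (m + n) :: 'a fps) $ 0 = 0" by simp
      then show False using 6 by simp
    qed
    ultimately show ?thesis by simp
  qed
qed

subsection \<open>The pentagonal number theorem\<close>

text \<open>The two terms of the summand are those of \<open>\<Sum>i. (- 1) ^ i * q ^ (3 * i\<^sup>2 + i)\<close> with \<open>i = 2 * j\<close> and
\<open>i = 2 * j - 1\<close>.\<close>

definition pentagonal_sum :: "int \<Rightarrow> 'a::field fps" where
  "pentagonal_sum L = (\<Sum>j=-L..L. fps_X ^ nat (12 * j\<^sup>2 + 2 * j) - fps_X ^ nat (12 * j\<^sup>2 - 10 * j + 2))"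

text \<open>Each \<open>inv_qfact a\<close> times the infinite product is 1 modulo
  \<open>fps_X ^ nat a\<close>. Where \<open>nat a\<close> falls short of \<open>M\<close>, the
  power of \<open>fps_X\<close> in front makes up for it.\<close>

lemma fps_cong_reflected_sum:
  "fps_cong M (reflected_sum L (int M) (int M) * (qpoch_inf fps_X fps_X)\<^sup>2) (pentagonal_sum L :: 'a::field fps)"
proof -
  let ?P = "qpoch_inf fps_X fps_X :: 'a fps"
  have *: "fps_cong M (fps_X ^ e * (inv_qfact a * inv_qfact b) * ?P\<^sup>2) (fps_X ^ e)"
    if "M \<le> e + nat a" "M \<le> e + nat b" for e a b
  proof -
    let ?k = "min (nat a) (nat b)"
    have "fps_cong ?k ((inv_qfact a * ?P) * (inv_qfact b * ?P)) (1 * 1)"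
      by (intro fps_cong_mult fps_cong_mono[OF fps_cong_inv_qfact]) auto
    then have "fps_cong M (fps_X ^ e * ((inv_qfact a * ?P) * (inv_qfact b * ?P))) (fps_X ^ e * (1 * 1))"
      by (rule fps_cong_X_power_mult) (use that in linarith)
    then show ?thesis
      by (simp add: power2_eq_square mult_ac)
  qed
  show ?thesis
    unfolding reflected_sum_def pentagonal_sum_def sum_distrib_right left_diff_distrib
  proof (intro fps_cong_sum fps_cong_diff *)
    fix j :: int
    note sq = abs_le_square_int[of j]
    show "M \<le> nat (12 * j\<^sup>2 + 2 * j) + nat (int M + 6 * j)" "M \<le> nat (12 * j\<^sup>2 + 2 * j) + nat (int M - 6 * j)"
      using sq by linarith+
    \<comment> \<open>No integer lies strictly between 1/3 and 1. Four times this quantity is the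
      excess of \<open>12 * j\<^sup>2 - 10 * j + 2 + (M + 2 - 6 * j)\<close> over
      \<open>M\<close>.\<close>
    have "(j - 1) * (3 * j - 1) \<ge> 0"
      by (cases "j \<ge> 1") (auto intro: mult_nonneg_nonneg mult_nonpos_nonpos)
    then have "3 * j\<^sup>2 - 4 * j + 1 \<ge> 0"
      by (simp add: power2_eq_square algebra_simps)
    then show "M \<le> nat (12 * j\<^sup>2 - 10 * j + 2) + nat (int M + 2 - 6 * j)"
      "M \<le> nat (12 * j\<^sup>2 - 10 * j + 2) + nat (int M - 2 + 6 * j)"
      using sq by linarith+
  qed
qed

text \<open>Shanks' finite form of the pentagonal number theorem, with \<open>q\<^sup>2\<close> in place of \<open>q\<close>.\<close>

lemma shanks_identity:
  fixes q :: "'a::comm_ring_1"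
  defines "W \<equiv> \<lambda>n k. \<Prod>j\<in>{k<..n}. 1 - q ^ (2 * j)"
  shows "(\<Sum>k\<le>n. (-1) ^ k * q ^ (2 * n * k + k * (k + 1)) * W n k)
       = 1 + (\<Sum>i<n. (-1) ^ Suc i * (q ^ ((i + 1) * (3 * i + 2)) + q ^ ((i + 1) * (3 * i + 4))))"
proof (induction n)
  case 0
  then show ?case by (simp add: W_def)
next
  case (Suc n)
  have W_Suc: "W (Suc n) k = W n k - q ^ (2 * Suc n) * W n k" if "k \<le> n" for k
  proof -
    have "{k<..Suc n} = insert (Suc n) {k<..n}"
      using that by auto
    then show ?thesis
      by (simp add: W_def algebra_simps)
  qed
  have W_Suc': "W n k = W n (Suc k) - q ^ (2 * Suc k) * W n (Suc k)" if "k < n" for k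
  proof -
    have "{k<..n} = insert (Suc k) {Suc k<..n}"
      using that by auto
    then show ?thesis
      by (simp add: W_def algebra_simps)
  qed
  have W_same: "W k k = 1" for k
    by (simp add: W_def)
  \<comment> \<open>\<open>a\<close> is the summand for \<open>n\<close>; \<open>b - c\<close> is
    the one for \<open>Suc n\<close> with the top factor of \<open>W\<close> split off. Splitting
    off the bottom factor gives \<open>b (Suc k) = a (Suc k) + c k\<close>, so the sum of
    \<open>b - c\<close> telescopes to the sum of \<open>a\<close> minus \<open>c n\<close>.\<close>
  define a b c where
    "a k = (-1) ^ k * q ^ (2 * n * k + k * (k + 1)) * W n k" and
    "b k = (-1) ^ k * q ^ (2 * Suc n * k + k * (k + 1)) * W n k" and
    "c k = (-1) ^ k * q ^ (2 * Suc n * Suc k + k * (k + 1)) * W n k" for k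
  have summand: "(-1) ^ k * q ^ (2 * Suc n * k + k * (k + 1)) * W (Suc n) k = b k - c k" if "k \<le> n" for k
  proof -
    have "2 * Suc n * Suc k + k * (k + 1) = (2 * Suc n * k + k * (k + 1)) + 2 * Suc n"
      by simp
    then show ?thesis
      unfolding W_Suc[OF that] b_def c_def by (simp only: power_add right_diff_distrib mult_ac)
  qed
  have b_Suc: "b (Suc k) = a (Suc k) + c k" if "k < n" for k
  proof -
    have 1: "2 * Suc n * Suc k + Suc k * (Suc k + 1) = (2 * n * Suc k + Suc k * (Suc k + 1)) + 2 * Suc k"
      by simp
    have 2: "2 * Suc n * Suc k + k * (k + 1) = 2 * n * Suc k + Suc k * (Suc k + 1)"
      by (simp add: algebra_simps)
    define E F where "E = 2 * n * Suc k + Suc k * (Suc k + 1)" and "F = 2 * Suc k"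
    show ?thesis
      unfolding a_def b_def c_def 1 2 W_Suc'[OF that] E_def[symmetric] F_def[symmetric]
      by (simp add: power_add algebra_simps)
  qed
  have bc: "(\<Sum>k\<le>n. b k) - (\<Sum>k\<le>n. c k) = (\<Sum>k\<le>n. a k) - c n"
  proof -
    have "sum b {..m} = sum a {..m} + sum c {..<m}" if "m \<le> n" for m
      using that
    proof (induction m)
      case 0
      then show ?case by (simp add: a_def b_def)
    next
      case (Suc m)
      then show ?case by (simp add: b_Suc)
    qed
    from this[of n] show ?thesis
      by (simp flip: lessThan_Suc_atMost)
  qed
  have lhs: "(\<Sum>k\<le>Suc n. (-1) ^ k * q ^ (2 * Suc n * k + k * (k + 1)) * W (Suc n) k)
      = (\<Sum>k\<le>n. b k) - (\<Sum>k\<le>n. c k) + (-1) ^ Suc n * q ^ (2 * Suc n * Suc n + Suc n * (Suc n + 1))"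
  proof -
    have "(\<Sum>k\<le>n. (-1) ^ k * q ^ (2 * Suc n * k + k * (k + 1)) * W (Suc n) k) = (\<Sum>k\<le>n. b k - c k)"
      by (intro sum.cong refl summand) simp
    then show ?thesis
      by (simp only: sum.atMost_Suc sum_subtractf W_same mult_1_right)
  qed
  \<comment> \<open>\<open>- c n\<close> and the last term \<open>k = Suc n\<close> are the two new
    powers on the right.\<close>
  have cn: "c n = (-1) ^ n * q ^ ((n + 1) * (3 * n + 2))"
    by (simp add: c_def W_same algebra_simps)
  have ex: "2 * Suc n * Suc n + Suc n * (Suc n + 1) = (n + 1) * (3 * n + 4)"
    by (simp add: algebra_simps)
  show ?case
    unfolding lhs bc cn ex Suc[folded a_def] sum.lessThan_Suc by (simp add: algebra_simps)
qed

text \<open>In terms of \<open>i\<close>, \<open>pentagonal_sum\<close> runs from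
  \<open>- 2 * l - 1\<close> to \<open>2 * l\<close> and the right-hand side from
  \<open>- 2 * l\<close> to \<open>2 * l\<close>; the added power cancels the negative term of
  \<open>i = - 2 * l - 1\<close>.\<close>

lemma pentagonal_sum_eq:
  "pentagonal_sum (int l) + fps_X ^ (12 * l\<^sup>2 + 10 * l + 2) =
   1 + (\<Sum>i<2 * l. (-1) ^ Suc i * (fps_X ^ ((i + 1) * (3 * i + 2)) + fps_X ^ ((i + 1) * (3 * i + 4))))"
proof (induction l)
  case 0
  then show ?case by (simp add: pentagonal_sum_def numeral_2_eq_2)
next
  case (Suc l)
  have set: "{- int (Suc l)..int (Suc l)} = insert (- int (Suc l)) (insert (int (Suc l)) {- int l..int l})"
    by auto
  have sq: "(int (Suc l))\<^sup>2 = int ((Suc l)\<^sup>2)" "(- int (Suc l))\<^sup>2 = int ((Suc l)\<^sup>2)"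
    by (simp_all only: power2_minus of_nat_power)
  have n: "(Suc l)\<^sup>2 = l\<^sup>2 + 2 * l + 1"
    by (simp add: power2_eq_square)
  have e: "nat (12 * (int (Suc l))\<^sup>2 + 2 * int (Suc l)) = 12 * l\<^sup>2 + 26 * l + 14"
    "nat (12 * (int (Suc l))\<^sup>2 - 10 * int (Suc l) + 2) = 12 * l\<^sup>2 + 14 * l + 4"
    "nat (12 * (- int (Suc l))\<^sup>2 + 2 * (- int (Suc l))) = 12 * l\<^sup>2 + 22 * l + 10"
    "nat (12 * (- int (Suc l))\<^sup>2 - 10 * (- int (Suc l)) + 2) = 12 * (Suc l)\<^sup>2 + 10 * Suc l + 2"
    unfolding sq n by (simp_all add: nat_eq_iff)
  have f: "(2 * l + 1) * (3 * (2 * l) + 2) = 12 * l\<^sup>2 + 10 * l + 2"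
    "(2 * l + 1) * (3 * (2 * l) + 4) = 12 * l\<^sup>2 + 14 * l + 4"
    "(Suc (2 * l) + 1) * (3 * Suc (2 * l) + 2) = 12 * l\<^sup>2 + 22 * l + 10"
    "(Suc (2 * l) + 1) * (3 * Suc (2 * l) + 4) = 12 * l\<^sup>2 + 26 * l + 14"
    by (simp_all add: power2_eq_square algebra_simps)
  have g: "2 * Suc l = Suc (Suc (2 * l))"
    by simp
  have "pentagonal_sum (int (Suc l)) = pentagonal_sum (int l) + 
     (fps_X ^ (12 * l\<^sup>2 + 26 * l + 14) - fps_X ^ (12 * l\<^sup>2 + 14 * l + 4)) +
     (fps_X ^ (12 * l\<^sup>2 + 22 * l + 10) - (fps_X :: 'a fps) ^ (12 * (Suc l)\<^sup>2 + 10 * Suc l + 2))"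
    unfolding pentagonal_sum_def set e[symmetric] by (subst sum.insert; simp)
  moreover have "(-1) ^ Suc (2 * l) = (-1 :: 'a fps)" "(-1) ^ Suc (Suc (2 * l)) = (1 :: 'a fps)"
    by simp_all
  ultimately show ?case
    unfolding g sum.lessThan_Suc f using Suc by (simp add: algebra_simps)
qed

text \<open>In Shanks' identity for \<open>2 * l\<close> the terms with \<open>k \<ge> 1\<close> are
  divisible by \<open>fps_X ^ l\<close>, and the term \<open>k = 0\<close> is the product.\<close>

lemma fps_cong_pentagonal_sum:
  "fps_cong l (pentagonal_sum (int l)) (qpoch_inf (fps_X\<^sup>2) (fps_X\<^sup>2) :: 'a::field fps)"
proof -
  let ?W = "\<lambda>n k. \<Prod>j\<in>{k<..n}. 1 - fps_X ^ (2 * j) :: 'a fps"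
  let ?t = "\<lambda>k. (-1) ^ k * fps_X ^ (2 * (2 * l) * k + k * (k + 1)) * ?W (2 * l) k :: 'a fps"
  have "fps_cong l (pentagonal_sum (int l)) (pentagonal_sum (int l) + (fps_X :: 'a fps) ^ (12 * l\<^sup>2 + 10 * l + 2))"
    unfolding fps_cong_def by (simp add: le_imp_power_dvd)
  then have 1: "fps_cong l (pentagonal_sum (int l)) (\<Sum>k\<le>2 * l. ?t k)"
    unfolding pentagonal_sum_eq shanks_identity .
  have 2: "(\<Sum>k\<le>2 * l. ?t k) = (\<Sum>k\<in>{..2 * l} - {0}. ?t k) + ?W (2 * l) 0"
    by (simp add: sum.remove[of "{..2 * l}" 0])
  have "fps_X ^ l dvd (\<Sum>k\<in>{..2 * l} - {0}. ?t k)"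
  proof (rule dvd_sum)
    fix k assume k: "k \<in> {..2 * l} - {0}"
    then have "l * 1 \<le> l * k" by (intro mult_le_mono) auto
    then have "l \<le> 2 * (2 * l) * k + k * (k + 1)" by linarith
    then show "fps_X ^ l dvd ?t k"
      by (intro dvd_mult2[OF dvd_mult] le_imp_power_dvd)
  qed
  then have 3: "fps_cong l (\<Sum>k\<le>2 * l. ?t k) (?W (2 * l) 0)"
    unfolding fps_cong_def 2 by simp
  have 4: "?W (2 * l) 0 = qpoch (fps_X\<^sup>2) (fps_X\<^sup>2) (2 * l)"
  proof -
    have "?W n 0 = qpoch (fps_X\<^sup>2) (fps_X\<^sup>2) n" for n
      unfolding qpoch_def
      by (intro prod.cong) (auto simp: power_mult simp flip: power_Suc)
    then show ?thesis .
  qed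
  have 5: "fps_cong l (qpoch (fps_X\<^sup>2) (fps_X\<^sup>2) (2 * l)) (qpoch_inf (fps_X\<^sup>2) (fps_X\<^sup>2) :: 'a fps)"
    by (rule fps_cong_mono[OF fps_cong_qpoch_inf]) auto
  show ?thesis
    by (rule fps_cong_trans[OF fps_cong_trans[OF 1 3] 5[folded 4]])
qed

subsection \<open>Pairs of interlaced partitions\<close>

text \<open>Such pairs of finite support are the cylindric partitions of profile (3, 1): two rows of
  level 4, dual to four rows of level 2.\<close>

definition interlaced :: "(nat \<Rightarrow> nat) \<Rightarrow> (nat \<Rightarrow> nat) \<Rightarrow> bool" where
  "interlaced x y \<longleftrightarrow> decseq x \<and> decseq y \<and> (\<forall>j. y (j + 1) \<le> x j) \<and> (\<forall>j. x (j + 3) \<le> y j)"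

text \<open>The bounds are integers so that the value \<open>- 1\<close>, for which there are no pairs, can serve as initial
value of the recurrence.\<close>

definition chain_pairs :: "int \<Rightarrow> int \<Rightarrow> ((nat \<Rightarrow> nat) \<times> (nat \<Rightarrow> nat)) set" where
  "chain_pairs m n = {(x, y). 0 \<le> m \<and> 0 \<le> n \<and> interlaced x y \<and>
     (\<forall>j. m \<le> int j \<longrightarrow> x j = 0) \<and> (\<forall>j. n \<le> int j \<longrightarrow> y j = 0)}"

definition support_sum :: "(nat \<Rightarrow> nat) \<Rightarrow> nat" where
  "support_sum x = (\<Sum>j | x j \<noteq> 0. x j)"

definition pairs_of_weight :: "int \<Rightarrow> int \<Rightarrow> nat \<Rightarrow> ((nat \<Rightarrow> nat) \<times> (nat \<Rightarrow> nat)) set" where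
  "pairs_of_weight m n s = {(x, y) \<in> chain_pairs m n. support_sum x + support_sum y = s}"

definition pair_gf :: "int \<Rightarrow> int \<Rightarrow> 'a::field fps" where
  "pair_gf m n = Abs_fps (\<lambda>s. of_nat (card (pairs_of_weight m n s)))"

lemma support_sum_eq:
  assumes "\<forall>j\<ge>N. x j = 0"
  shows "support_sum x = sum x {..<N}"
proof -
  have "j < N" if "x j \<noteq> 0" for j
    using assms that by (cases "N \<le> j") auto
  then show ?thesis
    unfolding support_sum_def by (intro sum.mono_neutral_left) auto
qed

lemma le_support_sum:
  assumes "\<forall>j\<ge>N. x j = 0"
  shows "x j \<le> support_sum x"
proof (cases "j < N")
  case True
  then show ?thesis
    unfolding support_sum_eq[OF assms] by (intro member_le_sum) auto
qed (use assms in auto)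

text \<open>If \<open>x j\<close> were positive, so would be all \<open>j + 1\<close> entries up to
  it, and the sum would exceed \<open>j\<close>.\<close>

lemma decseq_support_sum_zero:
  assumes "decseq x" "\<forall>j\<ge>N. x j = 0" "support_sum x \<le> j"
  shows "x j = 0"
proof (rule ccontr)
  assume "x j \<noteq> 0"
  then have "j < N"
    using assms(2) by (cases "j < N") auto
  have "x i \<ge> 1" if "i \<le> j" for i
    using decseqD[OF assms(1) that] \<open>x j \<noteq> 0\<close> by simp
  then have "(\<Sum>i\<le>j. 1) \<le> sum x {..j}"
    by (intro sum_mono) auto
  also have "\<dots> \<le> sum x {..<N}"
    using \<open>j < N\<close> by (intro sum_mono2) auto
  finally show False
    using assms(3) support_sum_eq[OF assms(2)] by simp
qed

lemma finite_pairs_of_weight: "finite (pairs_of_weight m n s)"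
proof -
  define F where "F k = {f. \<forall>j. (j \<in> {..<nat k} \<longrightarrow> f j \<in> {..s}) \<and> (j \<notin> {..<nat k} \<longrightarrow> f j = (0::nat))}" for k
  have "finite (F m \<times> F n)"
    unfolding F_def by (intro finite_cartesian_product finite_set_of_finite_funs) auto
  moreover have "pairs_of_weight m n s \<subseteq> F m \<times> F n"
  proof (clarify)
    fix x y assume "(x, y) \<in> pairs_of_weight m n s"
    then have xy: "\<forall>j\<ge>nat m. x j = 0" "\<forall>j\<ge>nat n. y j = 0" "support_sum x + support_sum y = s"
      by (auto simp: pairs_of_weight_def chain_pairs_def)
    have "x j \<le> s" "y j \<le> s" for j
      using le_support_sum[OF xy(1), of j] le_support_sum[OF xy(2), of j] xy(3) by auto
    then show "x \<in> F m \<and> y \<in> F n"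
      using xy by (auto simp: F_def)
  qed
  ultimately show ?thesis
    by (rule finite_subset[rotated])
qed

lemma chain_pairs_Int: "chain_pairs (m - 1) n \<inter> chain_pairs m (n - 1) = chain_pairs (m - 1) (n - 1)"
  by (auto simp: chain_pairs_def)

definition full_pairs :: "nat \<Rightarrow> nat \<Rightarrow> ((nat \<Rightarrow> nat) \<times> (nat \<Rightarrow> nat)) set" where
  "full_pairs m n = {(x, y). (\<forall>j<m. x j \<noteq> 0) \<and> (\<forall>j<n. y j \<noteq> 0)}"

text \<open>By monotonicity a zero below the bound makes the last admissible entry vanish. With
  \<open>chain_pairs_Int\<close> this is the inclusion-exclusion behind
  \<open>pair_gf_rec\<close>.\<close>

lemma chain_pairs_not_full:
  assumes "0 \<le> m" "0 \<le> n"
  shows "chain_pairs m n - full_pairs (nat m) (nat n) = chain_pairs (m - 1) n \<union> chain_pairs m (n - 1)"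
proof (intro equalityI subsetI; clarify)
  fix x y assume *: "(x, y) \<in> chain_pairs m n" "(x, y) \<notin> full_pairs (nat m) (nat n)"
    "(x, y) \<notin> chain_pairs m (n - 1)"
  have dec: "decseq x" "decseq y"
    using *(1) by (auto simp: chain_pairs_def interlaced_def)
  show "(x, y) \<in> chain_pairs (m - 1) n"
  proof (cases "\<exists>j<nat m. x j = 0")
    case True
    then obtain j where j: "j < nat m" "x j = 0" by blast
    have "x i = 0" if "m - 1 \<le> int i" for i
      using decseqD[OF dec(1), of j i] j that by force
    then show ?thesis
      using *(1) j by (auto simp: chain_pairs_def)
  next
    case False
    then obtain j where j: "j < nat n" "y j = 0"
      using *(2) by (auto simp: full_pairs_def)
    have "y i = 0" if "n - 1 \<le> int i" for i
      using decseqD[OF dec(2), of j i] j that by force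
    then have "(x, y) \<in> chain_pairs m (n - 1)"
      using *(1) j by (auto simp: chain_pairs_def)
    with *(3) show ?thesis by blast
  qed
next
  fix x y assume *: "(x, y) \<in> chain_pairs (m - 1) n \<union> chain_pairs m (n - 1)"
  have "(x, y) \<in> chain_pairs m n"
    using * by (auto simp: chain_pairs_def)
  moreover have "(x, y) \<notin> full_pairs (nat m) (nat n)"
  proof
    assume "(x, y) \<in> full_pairs (nat m) (nat n)"
    then have f: "\<And>j. j < nat m \<Longrightarrow> x j \<noteq> 0" "\<And>j. j < nat n \<Longrightarrow> y j \<noteq> 0"
      by (auto simp: full_pairs_def)
    from * show False
    proof
      assume "(x, y) \<in> chain_pairs (m - 1) n"
      then show False
        using f(1)[of "nat (m - 1)"] by (auto simp: chain_pairs_def)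
    next
      assume "(x, y) \<in> chain_pairs m (n - 1)"
      then show False
        using f(2)[of "nat (n - 1)"] by (auto simp: chain_pairs_def)
    qed
  qed
  ultimately show "(x, y) \<in> chain_pairs m n - full_pairs (nat m) (nat n)"
    by blast
qed

lemma support_sum_add_of_bool:
  assumes "\<forall>j\<ge>m. x j = 0"
  shows "support_sum (\<lambda>j. x j + of_bool (j < m)) = support_sum x + m"
proof -
  have "support_sum (\<lambda>j. x j + of_bool (j < m)) = (\<Sum>j<m. x j + of_bool (j < m))"
    by (rule support_sum_eq) (use assms in auto)
  also have "\<dots> = sum x {..<m} + (\<Sum>j<m. of_bool (j < m))"
    by (rule sum.distrib)
  finally show ?thesis
    using support_sum_eq[OF assms] by simp
qed

text \<open>The inverse lowers every part by 1. Raising keeps the pair interlaced because, by the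
  assumptions, \<open>j + 1 < n\<close> implies \<open>j < m\<close>, and \<open>j + 3 < m\<close>
  implies \<open>j < n\<close>.\<close>

lemma bij_betw_full_pairs:
  assumes "n \<le> m + 1" "m \<le> n + 3"
  shows "bij_betw (\<lambda>(x, y). (\<lambda>j. x j + of_bool (j < m), \<lambda>j. y j + of_bool (j < n)))
    (pairs_of_weight (int m) (int n) s) (pairs_of_weight (int m) (int n) (s + m + n) \<inter> full_pairs m n)"
    (is "bij_betw ?U ?A ?B")
proof (rule bij_betw_byWitness[where f' = "\<lambda>(x, y). (\<lambda>j. x j - 1, \<lambda>j. y j - 1)"])
  show "\<forall>p\<in>?A. (case ?U p of (x, y) \<Rightarrow> (\<lambda>j. x j - 1, \<lambda>j. y j - 1)) = p"
    by (auto simp: pairs_of_weight_def chain_pairs_def fun_eq_iff)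
  have inv: "?U ((\<lambda>(x, y). (\<lambda>j. x j - 1, \<lambda>j. y j - 1)) (x, y)) = (x, y)" if "(x, y) \<in> ?B" for x y
    using that by (auto simp: pairs_of_weight_def chain_pairs_def full_pairs_def fun_eq_iff)
  then show "\<forall>p\<in>?B. ?U (case p of (x, y) \<Rightarrow> (\<lambda>j. x j - 1, \<lambda>j. y j - 1)) = p"
    by auto
  show "?U ` ?A \<subseteq> ?B"
  proof clarify
    fix x y assume xy: "(x, y) \<in> ?A"
    then have z: "\<forall>j\<ge>m. x j = 0" "\<forall>j\<ge>n. y j = 0"
      by (auto simp: pairs_of_weight_def chain_pairs_def)
    have i: "interlaced x y"
      using xy by (auto simp: pairs_of_weight_def chain_pairs_def)
    have "interlaced (\<lambda>j. x j + of_bool (j < m)) (\<lambda>j. y j + of_bool (j < n))"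
      unfolding interlaced_def decseq_Suc_iff
    proof (intro conjI allI add_mono)
      fix j
      show "x (Suc j) \<le> x j" "y (Suc j) \<le> y j" "y (j + 1) \<le> x j" "x (j + 3) \<le> y j"
        using i by (auto simp: interlaced_def decseq_Suc_iff)
    qed (use assms in auto)
    moreover have "support_sum (\<lambda>j. x j + of_bool (j < m)) + support_sum (\<lambda>j. y j + of_bool (j < n)) = s + m + n"
      using xy by (simp add: support_sum_add_of_bool z pairs_of_weight_def)
    ultimately show "(\<lambda>j. x j + of_bool (j < m), \<lambda>j. y j + of_bool (j < n)) \<in> ?B"
      using z by (auto simp: pairs_of_weight_def chain_pairs_def full_pairs_def)
  qed
  show "(\<lambda>(x, y). (\<lambda>j. x j - 1, \<lambda>j. y j - 1)) ` ?B \<subseteq> ?A"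
  proof (rule image_subsetI)
    fix p assume p: "p \<in> ?B"
    obtain x y where p_eq: "p = (x, y)"
      by (cases p)
    note xy = p[unfolded p_eq]
    then have z: "\<forall>j\<ge>m. x j - 1 = 0" "\<forall>j\<ge>n. y j - 1 = 0"
      by (auto simp: pairs_of_weight_def chain_pairs_def)
    have i: "interlaced x y"
      using xy by (auto simp: pairs_of_weight_def chain_pairs_def)
    have "interlaced (\<lambda>j. x j - 1) (\<lambda>j. y j - 1)"
      using i unfolding interlaced_def decseq_Suc_iff by (auto intro!: diff_le_mono)
    moreover have "support_sum x + support_sum y = s + m + n"
      using xy by (auto simp: pairs_of_weight_def)
    then have "support_sum (\<lambda>j. x j - 1) + support_sum (\<lambda>j. y j - 1) = s"
      using inv[OF xy] support_sum_add_of_bool[OF z(1)]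
        support_sum_add_of_bool[OF z(2)] by simp
    ultimately show "(case p of (x, y) \<Rightarrow> (\<lambda>j. x j - 1, \<lambda>j. y j - 1)) \<in> ?A"
      using z by (auto simp: p_eq pairs_of_weight_def chain_pairs_def)
  qed
qed

lemma full_pairs_weight:
  assumes "(x, y) \<in> pairs_of_weight (int m) (int n) s \<inter> full_pairs m n"
  shows "m + n \<le> s"
proof -
  have z: "\<forall>j\<ge>m. x j = 0" "\<forall>j\<ge>n. y j = 0" and s: "support_sum x + support_sum y = s"
    and f: "\<And>j. j < m \<Longrightarrow> 1 \<le> x j" "\<And>j. j < n \<Longrightarrow> 1 \<le> y j"
    using assms by (auto simp: pairs_of_weight_def chain_pairs_def full_pairs_def Suc_le_eq)
  have "(\<Sum>j<m. 1) \<le> support_sum x" "(\<Sum>j<n. 1) \<le> support_sum y"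
    unfolding support_sum_eq[OF z(1)] support_sum_eq[OF z(2)] by (intro sum_mono f; simp)+
  with s show ?thesis by simp
qed

text \<open>Full pairs contribute \<open>fps_X ^ nat (m + n) * pair_gf m n\<close>; the others are
  counted by inclusion-exclusion.\<close>

lemma pair_gf_rec:
  assumes "0 \<le> m" "0 \<le> n" "0 < m + n" "n \<le> m + 1" "m \<le> n + 3"
  shows "(1 - fps_X ^ nat (m + n)) * pair_gf m n =
         pair_gf (m - 1) n + pair_gf m (n - 1) - (pair_gf (m - 1) (n - 1) :: 'a::field fps)"
proof (rule fps_ext)
  fix s
  define a b where "a = nat m" and "b = nat n"
  have ab: "m = int a" "n = int b" "nat (m + n) = a + b" "b \<le> a + 1" "a \<le> b + 3"
    using assms by (auto simp: a_def b_def)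
  let ?W = "\<lambda>m n. pairs_of_weight m n s"
  let ?full = "?W m n \<inter> full_pairs a b"
  have "?W m n - full_pairs a b = ?W (m - 1) n \<union> ?W m (n - 1)"
    using chain_pairs_not_full[OF assms(1,2)] unfolding a_def b_def pairs_of_weight_def by blast
  then have "card (?W m n) = card ?full + card (?W (m - 1) n \<union> ?W m (n - 1))"
    using card_Int_Diff[OF finite_pairs_of_weight[of m n s], of "full_pairs a b"] by simp
  moreover have "card (?W (m - 1) n) + card (?W m (n - 1)) =
      card (?W (m - 1) n \<union> ?W m (n - 1)) + card (?W (m - 1) (n - 1))"
  proof -
    have "?W (m - 1) n \<inter> ?W m (n - 1) = ?W (m - 1) (n - 1)"
      using chain_pairs_Int[of m n] unfolding pairs_of_weight_def by blast
    then show ?thesis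
      using card_Un_Int[OF finite_pairs_of_weight finite_pairs_of_weight] by metis
  qed
  moreover have "card ?full = (if s < a + b then 0 else card (pairs_of_weight m n (s - (a + b))))"
  proof (cases "s < a + b")
    case True
    then have "?full = {}"
      using full_pairs_weight[of _ _ a b s] unfolding ab by force
    then show ?thesis using True by simp
  next
    case False
    then have "s - (a + b) + a + b = s" by simp
    then show ?thesis
      using bij_betw_same_card[OF bij_betw_full_pairs[OF ab(4,5), of "s - (a + b)"]] False
      unfolding ab by simp
  qed
  ultimately have "card (?W m n) + card (?W (m - 1) (n - 1)) =
      (if s < a + b then 0 else card (pairs_of_weight m n (s - (a + b)))) + card (?W (m - 1) n) + card (?W m (n - 1))"
    by linarith
  then have "(of_nat (card (?W m n)) :: 'a) + of_nat (card (?W (m - 1) (n - 1))) =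
      (if s < a + b then 0 else of_nat (card (pairs_of_weight m n (s - (a + b)))))
      + of_nat (card (?W (m - 1) n)) + of_nat (card (?W m (n - 1)))"
    by (simp flip: of_nat_add add: if_distrib)
  then show "((1 - fps_X ^ nat (m + n)) * pair_gf m n) $ s =
         (pair_gf (m - 1) n + pair_gf m (n - 1) - (pair_gf (m - 1) (n - 1) :: 'a fps)) $ s"
    unfolding ab(3) pair_gf_def by (simp add: left_diff_distrib fps_X_power_mult_nth algebra_simps)
qed

lemma pair_gf_0_0: "pair_gf 0 0 = 1"
proof -
  have "interlaced (\<lambda>_. 0) (\<lambda>_. 0)"
    by (simp add: interlaced_def decseq_def)
  then have c: "chain_pairs 0 0 = {(\<lambda>_. 0, \<lambda>_. 0)}"
    by (auto simp: chain_pairs_def fun_eq_iff)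
  have "pairs_of_weight 0 0 s = (if s = 0 then {(\<lambda>_. 0, \<lambda>_. 0)} else {})" for s
    unfolding pairs_of_weight_def c by (auto simp: support_sum_def)
  then show ?thesis
    by (simp add: pair_gf_def fps_eq_iff)
qed

lemma pair_gf_eq_reflected_sum:
  assumes "n < L"
  shows "pair_gf (int n) (int n) = (reflected_sum (int L) (int n) (int n) :: 'a::field fps)"
proof (rule reflected_sum_unique[where f = pair_gf])
  show "pair_gf (-1) n = (0 :: 'a fps)" "pair_gf n (-1) = (0 :: 'a fps)" for n
    by (simp_all add: pair_gf_def pairs_of_weight_def chain_pairs_def fps_eq_iff)
  show "pair_gf 0 0 = (1 :: 'a fps)"
    by (rule pair_gf_0_0)
  show "pair_gf m (m + 2) = (pair_gf m (m + 1) :: 'a fps)" if "0 \<le> m" for m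
  proof -
    \<comment> \<open>The interlacing gives \<open>y j \<le> x (j - 1) = 0\<close>, so the larger
      bound admits no new pair.\<close>
    have "y j = 0" if "interlaced x y" "\<forall>j. m \<le> int j \<longrightarrow> x j = 0" "\<forall>j. m + 2 \<le> int j \<longrightarrow> y j = 0" "m + 1 \<le> int j" for x y j
    proof -
      have "j = j - 1 + 1" "m \<le> int (j - 1)"
        using that(4) \<open>0 \<le> m\<close> by auto
      then show ?thesis
        using that(1,2) unfolding interlaced_def by (metis le_zero_eq)
    qed
    then have "chain_pairs m (m + 2) = chain_pairs m (m + 1)"
      using that by (auto simp: chain_pairs_def)
    then show ?thesis
      by (simp add: pair_gf_def pairs_of_weight_def)
  qed
  show "pair_gf (n + 4) n = (pair_gf (n + 3) n :: 'a fps)" if "0 \<le> n" for n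
  proof -
    have "x j = 0" if "interlaced x y" "\<forall>j. n \<le> int j \<longrightarrow> y j = 0" "n + 3 \<le> int j" for x y j
    proof -
      have "j = j - 3 + 3" "n \<le> int (j - 3)"
        using that(3) \<open>0 \<le> n\<close> by auto
      then show ?thesis
        using that(1,2) unfolding interlaced_def by (metis le_zero_eq)
    qed
    then have "chain_pairs (n + 4) n = chain_pairs (n + 3) n"
      using that by (auto simp: chain_pairs_def)
    then show ?thesis
      by (simp add: pair_gf_def pairs_of_weight_def)
  qed
qed (use assms in \<open>auto intro: pair_gf_rec\<close>)

subsection \<open>Level-rank duality\<close>

lemma all_mod_2: "(\<forall>j. Q j) \<longleftrightarrow> (\<forall>k. Q (2 * k) \<and> Q (2 * k + 1))" for Q :: "nat \<Rightarrow> bool"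
proof
  assume *: "\<forall>k. Q (2 * k) \<and> Q (2 * k + 1)"
  show "\<forall>j. Q j"
  proof
    fix j :: nat
    have "j = 2 * (j div 2) \<or> j = 2 * (j div 2) + 1" by presburger
    then show "Q j" using * by metis
  qed
qed blast

lemma all_mod_4: "(\<forall>j. Q j) \<longleftrightarrow> (\<forall>k. Q (4 * k) \<and> Q (4 * k + 1) \<and> Q (4 * k + 2) \<and> Q (4 * k + 3))" for Q :: "nat \<Rightarrow> bool"
proof
  assume *: "\<forall>k. Q (4 * k) \<and> Q (4 * k + 1) \<and> Q (4 * k + 2) \<and> Q (4 * k + 3)"
  show "\<forall>j. Q j"
  proof
    fix j :: nat
    have "j = 4 * (j div 4) \<or> j = 4 * (j div 4) + 1 \<or> j = 4 * (j div 4) + 2 \<or> j = 4 * (j div 4) + 3"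
      by presburger
    then show "Q j" using * by metis
  qed
qed blast

definition deal4 :: "(nat \<Rightarrow> 'a) \<Rightarrow> (nat \<Rightarrow> 'a) \<Rightarrow> (nat \<Rightarrow> 'a) \<Rightarrow> (nat \<Rightarrow> 'a) \<Rightarrow> nat \<Rightarrow> 'a" where
  "deal4 a b c d j = ([a, b, c, d] ! (j mod 4)) (j div 4)"

lemma deal4_simps [simp]:
  "deal4 a b c d (4 * k) = a k" "deal4 a b c d (4 * k + 1) = b k"
  "deal4 a b c d (4 * k + 2) = c k" "deal4 a b c d (4 * k + 3) = d k"
  "deal4 a b c d (4 * k + 4) = a (k + 1)" "deal4 a b c d (4 * k + 5) = b (k + 1)"
  "deal4 a b c d (4 * k + 6) = c (k + 1)"
proof -
  have m: "(4 * k) mod 4 = 0" "(4 * k + 1) mod 4 = 1" "(4 * k + 2) mod 4 = 2" "(4 * k + 3) mod 4 = 3"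
    "(4 * k + 4) mod 4 = 0" "(4 * k + 5) mod 4 = 1" "(4 * k + 6) mod 4 = 2"
    "(4 * k) div 4 = k" "(4 * k + 1) div 4 = k" "(4 * k + 2) div 4 = k" "(4 * k + 3) div 4 = k"
    "(4 * k + 4) div 4 = k + 1" "(4 * k + 5) div 4 = k + 1" "(4 * k + 6) div 4 = k + 1"
    by presburger+
  show "deal4 a b c d (4 * k) = a k" "deal4 a b c d (4 * k + 1) = b k"
  "deal4 a b c d (4 * k + 2) = c k" "deal4 a b c d (4 * k + 3) = d k"
  "deal4 a b c d (4 * k + 4) = a (k + 1)" "deal4 a b c d (4 * k + 5) = b (k + 1)"
  "deal4 a b c d (4 * k + 6) = c (k + 1)"
    unfolding deal4_def m by simp_all
qed

text \<open>The cells of the cylindric poset fall into two chains: \<open>chain_x\<close> starts at the first cell of row \<open>b\<close>, \<open>chain_y\<close> at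
the first cell of row \<open>a\<close>, and both run through the rows cyclically, following the inequalities
between different rows.\<close>

definition chain_x :: "(nat \<Rightarrow> nat) \<Rightarrow> (nat \<Rightarrow> nat) \<Rightarrow> (nat \<Rightarrow> nat) \<Rightarrow> (nat \<Rightarrow> nat) \<Rightarrow> nat \<Rightarrow> nat" where
  "chain_x a b c d = deal4 (\<lambda>k. b (2 * k)) (\<lambda>k. c (2 * k)) (\<lambda>k. d (2 * k)) (\<lambda>k. a (2 * k + 1))"

definition chain_y :: "(nat \<Rightarrow> nat) \<Rightarrow> (nat \<Rightarrow> nat) \<Rightarrow> (nat \<Rightarrow> nat) \<Rightarrow> (nat \<Rightarrow> nat) \<Rightarrow> nat \<Rightarrow> nat" where
  "chain_y a b c d = deal4 (\<lambda>k. a (2 * k)) (\<lambda>k. b (2 * k + 1)) (\<lambda>k. c (2 * k + 1)) (\<lambda>k. d (2 * k + 1))"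

text \<open>Decrease along the chains encodes the inequalities between different rows, the two
  interlacing conditions the decrease within rows. Splitting by residues modulo 4 on one side and by
  parity on the other gives the same sixteen families.\<close>

lemma interlaced_chain_iff:
  "interlaced (chain_x a b c d) (chain_y a b c d) \<longleftrightarrow>
     decseq a \<and> decseq b \<and> decseq c \<and> decseq d \<and>
     (\<forall>j. b (j + 1) \<le> a j) \<and> (\<forall>j. c j \<le> b j) \<and> (\<forall>j. d j \<le> c j) \<and> (\<forall>j. a (j + 1) \<le> d j)"
proof -
  have s: "Suc (4 * k) = 4 * k + 1" "4 * k + 1 + 1 = 4 * k + 2" "4 * k + 2 + 1 = 4 * k + 3" "4 * k + 3 + 1 = 4 * k + 4"
    "4 * k + 1 + 3 = 4 * k + 4" "4 * k + 2 + 3 = 4 * k + 5" "4 * k + 3 + 3 = 4 * k + 6"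
    "2 * (k + 1) = 2 * k + 2" "2 * k + 1 + 1 = 2 * k + 2" "2 * (k + 1) + 1 = 2 * k + 3" for k :: nat
    by simp_all
  have L: "interlaced (chain_x a b c d) (chain_y a b c d) \<longleftrightarrow> (\<forall>k.
    (c (2*k) \<le> b (2*k) \<and> d (2*k) \<le> c (2*k) \<and> a (2*k+1) \<le> d (2*k) \<and> b (2*k+2) \<le> a (2*k+1)) \<and>
    (b (2*k+1) \<le> a (2*k) \<and> c (2*k+1) \<le> b (2*k+1) \<and> d (2*k+1) \<le> c (2*k+1) \<and> a (2*k+2) \<le> d (2*k+1)) \<and>
    (b (2*k+1) \<le> b (2*k) \<and> c (2*k+1) \<le> c (2*k) \<and> d (2*k+1) \<le> d (2*k) \<and> a (2*k+2) \<le> a (2*k+1)) \<and>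
    (a (2*k+1) \<le> a (2*k) \<and> b (2*k+2) \<le> b (2*k+1) \<and> c (2*k+2) \<le> c (2*k+1) \<and> d (2*k+2) \<le> d (2*k+1)))"
    unfolding interlaced_def decseq_Suc_iff Suc_eq_plus1 chain_x_def chain_y_def all_mod_4[where Q = "\<lambda>j. deal4 _ _ _ _ (j + _) \<le> _ j"]
      s deal4_simps by (simp only: all_conj_distrib conj_ac)
  show ?thesis
    unfolding L decseq_Suc_iff Suc_eq_plus1 all_mod_2[where Q = "\<lambda>j. _ (j + 1) \<le> _ j"]
      all_mod_2[where Q = "\<lambda>j. _ j \<le> _ j"] s
    by (simp only: all_conj_distrib conj_ac)
qed

lemma chain_surj:
  obtains a b c d where "x = chain_x a b c d" "y = chain_y a b c d"
proof
  \<comment> \<open>The rows are read back off the chains. Row \<open>a\<close> is special: its even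
    cells lie in \<open>y\<close> and its odd cells in \<open>x\<close>, the reverse of the rows
    \<open>r i\<close>.\<close>
  define a where "a j = (if even j then y (4 * (j div 2)) else x (4 * (j div 2) + 3))" for j
  define r where "r i j = (if even j then x (4 * (j div 2) + i) else y (4 * (j div 2) + i + 1))" for i j
  have e: "even (2 * k) = True" "even (2 * k + 1) = False" "2 * k div 2 = k" "(2 * k + 1) div 2 = k"
    "4 * k + 0 = 4 * k" "4 * k + 0 + 1 = 4 * k + 1" "4 * k + 1 + 1 = 4 * k + 2" "4 * k + 2 + 1 = 4 * k + 3" for k :: nat
    by simp_all
  show "x = chain_x a (r 0) (r 1) (r 2)" "y = chain_y a (r 0) (r 1) (r 2)"
    unfolding fun_eq_iff all_mod_4[where Q = "\<lambda>j. _ j = _ j"] chain_x_def chain_y_def deal4_simps a_def r_def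
    by (simp_all only: e if_True if_False simp_thms)
qed

lemma sum_mod_2: "(\<Sum>j<2 * K. f j) = (\<Sum>k<K. f (2 * k) + f (2 * k + 1))" for f :: "nat \<Rightarrow> nat"
  by (induction K) (simp_all add: eval_nat_numeral)

lemma sum_mod_4: "(\<Sum>j<4 * K. f j) = (\<Sum>k<K. f (4 * k) + f (4 * k + 1) + f (4 * k + 2) + f (4 * k + 3))"
  for f :: "nat \<Rightarrow> nat"
proof (induction K)
  case (Suc K)
  have "4 * Suc K = Suc (Suc (Suc (Suc (4 * K))))" by simp
  then show ?case by (simp only: sum.lessThan_Suc Suc) (simp add: eval_nat_numeral)
qed simp

text \<open>The first \<open>2 * K\<close> cells of the four rows fill exactly the first
  \<open>4 * K\<close> places of both chains.\<close>

lemma chain_zero: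
  assumes "\<forall>j\<ge>2 * K. a j = 0 \<and> b j = 0 \<and> c j = 0 \<and> d j = 0" "4 * K \<le> j"
  shows "chain_x a b c d j = 0" "chain_y a b c d j = 0"
proof -
  have k: "K \<le> j div 4" using assms(2) by simp
  have "j mod 4 < 4" by simp
  then have "j mod 4 = 0 \<or> j mod 4 = 1 \<or> j mod 4 = 2 \<or> j mod 4 = 3" by linarith
  then show "chain_x a b c d j = 0" "chain_y a b c d j = 0"
    using k by (auto simp: chain_x_def chain_y_def deal4_def assms(1))
qed

lemma support_sum_chain:
  assumes "\<forall>j\<ge>2 * K. a j = 0 \<and> b j = 0 \<and> c j = 0 \<and> d j = 0"
  shows "support_sum (chain_x a b c d) + support_sum (chain_y a b c d) = support_sum a + support_sum b + support_sum c + support_sum d"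
proof -
  have "support_sum (chain_x a b c d) = sum (chain_x a b c d) {..<4 * K}" "support_sum (chain_y a b c d) = sum (chain_y a b c d) {..<4 * K}"
    by (intro support_sum_eq allI impI chain_zero[OF assms]; assumption)+
  moreover have "support_sum a = sum a {..<2 * K}" "support_sum b = sum b {..<2 * K}" "support_sum c = sum c {..<2 * K}" "support_sum d = sum d {..<2 * K}"
    by (rule support_sum_eq; use assms in blast)+
  ultimately show ?thesis
    unfolding sum_mod_2 sum_mod_4 chain_x_def chain_y_def deal4_simps by (simp add: sum.distrib)
qed

lemma part_zero: "length l \<le> j \<Longrightarrow> part l j = 0"
  by (simp add: part_def)

lemma support_sum_part: "support_sum (part l) = sum_list l"
proof -
  have "support_sum (part l) = sum (part l) {..<length l}"
    by (rule support_sum_eq) (simp add: part_zero)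
  then show ?thesis
    by (simp add: sum_list_sum_nth part_def atLeast0LessThan)
qed

lemma decseq_part: "is_partition l \<Longrightarrow> decseq (part l)"
  unfolding is_partition_def decseq_Suc_iff part_def
  by (auto simp: sorted_wrt_iff_nth_less)

lemma part_inj:
  assumes "is_partition l" "is_partition l'" "part l = part l'"
  shows "l = l'"
proof -
  have pos: "part l j \<noteq> 0 \<longleftrightarrow> j < length l" if "is_partition l" for l j
    using that unfolding is_partition_def part_def by (auto simp: in_set_conv_nth)
  have "j < length l \<longleftrightarrow> j < length l'" for j
    using pos[OF assms(1), of j] pos[OF assms(2), of j] assms(3) by simp
  then have len: "length l = length l'"
    by (metis less_irrefl linorder_neqE_nat)
  then show ?thesis
  proof (rule nth_equalityI)
    fix j assume "j < length l"
    then show "l ! j = l' ! j"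
      using fun_cong[OF assms(3), of j] len by (simp add: part_def)
  qed
qed

lemma part_surj:
  assumes "decseq f" "f N = 0"
  obtains l where "is_partition l" "f = part l"
proof
  define n where "n = (LEAST n. f n = 0)"
  have n: "f n = 0" unfolding n_def by (rule LeastI) (rule assms(2))
  have pos: "f j \<noteq> 0" if "j < n" for j
    using that unfolding n_def by (rule not_less_Least)
  have z: "f j = 0" if "n \<le> j" for j
    using decseqD[OF assms(1) that] n by simp
  show "is_partition (map f [0..<n])"
    unfolding is_partition_def sorted_wrt_iff_nth_less
    by (auto intro: decseqD[OF assms(1)] dest: pos)
  show "f = part (map f [0..<n])"
    by (auto simp: fun_eq_iff part_def z)
qed

text \<open>The profile conditions are the four row inequalities of
  \<open>interlaced_chain_iff\<close>; \<open>is_partition\<close> supplies the decrease within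
  rows.\<close>

lemma cylindric_partitions_1100:
  "\<Lambda> \<in> cylindric_partitions [1, 1, 0, 0] \<longleftrightarrow> (\<exists>a b c d. \<Lambda> = [a, b, c, d] \<and>
     is_partition a \<and> is_partition b \<and> is_partition c \<and> is_partition d \<and>
     interlaced (chain_x (part a) (part b) (part c) (part d)) (chain_y (part a) (part b) (part c) (part d)))"
  (is "_ \<longleftrightarrow> ?R")
proof -
  have *: "[a, b, c, d] \<in> cylindric_partitions [1, 1, 0, 0] \<longleftrightarrow>
     is_partition a \<and> is_partition b \<and> is_partition c \<and> is_partition d \<and>
     (\<forall>j. part b (j + 1) \<le> part a j) \<and> (\<forall>j. part c j \<le> part b j) \<and> (\<forall>j. part d j \<le> part c j) \<and>
     (\<forall>j. part a (j + 1) \<le> part d j)" for a b c d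
  proof -
    have 4: "(\<forall>i<4. Q i) \<longleftrightarrow> Q 0 \<and> Q 1 \<and> Q 2 \<and> Q 3" for Q :: "nat \<Rightarrow> bool"
      by (auto simp: eval_nat_numeral less_Suc_eq)
    have 3: "(\<forall>i j. i + 1 < 4 \<longrightarrow> Q i j) \<longleftrightarrow> (\<forall>j. Q 0 j) \<and> (\<forall>j. Q 1 j) \<and> (\<forall>j. Q 2 j)" for Q :: "nat \<Rightarrow> nat \<Rightarrow> bool"
      by (auto simp: eval_nat_numeral less_Suc_eq)
    have len: "length [1, 1, 0, 0 :: nat] = 4" "length [a, b, c, d] = 4"
      by simp_all
    show ?thesis
      unfolding cylindric_partitions_def mem_Collect_eq Let_def len 4 3
      by (simp add: eval_nat_numeral)
  qed
  have "\<exists>a b c d. \<Lambda> = [a, b, c, d]" if "\<Lambda> \<in> cylindric_partitions [1, 1, 0, 0]"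
  proof -
    have "length \<Lambda> = Suc (Suc (Suc (Suc 0)))"
      using that by (simp add: cylindric_partitions_def Let_def)
    then show ?thesis by (simp add: length_Suc_conv) blast
  qed
  then show ?thesis
    using * decseq_part by (auto simp: interlaced_chain_iff)
qed

definition to_chains :: "nat list list \<Rightarrow> (nat \<Rightarrow> nat) \<times> (nat \<Rightarrow> nat)" where
  "to_chains \<Lambda> = (let p = (\<lambda>i. part (\<Lambda> ! i)) in (chain_x (p 0) (p 1) (p 2) (p 3), chain_y (p 0) (p 1) (p 2) (p 3)))"

lemma to_chains_simp: 
  "to_chains [a, b, c, d] = (chain_x (part a) (part b) (part c) (part d), chain_y (part a) (part b) (part c) (part d))"
  by (simp add: to_chains_def eval_nat_numeral)

lemma chain_inj:
  assumes "chain_x a b c d = chain_x a' b' c' d'" "chain_y a b c d = chain_y a' b' c' d'"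
  shows "a = a'" "b = b'" "c = c'" "d = d'"
  using assms[unfolded fun_eq_iff all_mod_4[where Q = "\<lambda>j. _ j = _ j"] chain_x_def chain_y_def deal4_simps]
  unfolding fun_eq_iff all_mod_2[where Q = "\<lambda>j. _ j = _ j"] by blast+

text \<open>The bound \<open>n\<close> loses nothing: a decreasing sequence of sum at most
  \<open>s\<close> vanishes from index \<open>s\<close> on, and \<open>s \<le> n\<close>.\<close>

lemma bij_betw_to_chains:
  assumes "s \<le> n"
  shows "bij_betw to_chains {\<Lambda> \<in> cylindric_partitions [1, 1, 0, 0]. cyl_size \<Lambda> = s} (pairs_of_weight (int n) (int n) s)"
    (is "bij_betw _ ?A ?B")
proof -
  have "inj_on to_chains ?A"
  proof (rule inj_onI)
    fix \<Lambda> \<Lambda>' assume "\<Lambda> \<in> ?A" "\<Lambda>' \<in> ?A" and e: "to_chains \<Lambda> = to_chains \<Lambda>'"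
    then obtain a b c d a' b' c' d' where L: "\<Lambda> = [a, b, c, d]" "\<Lambda>' = [a', b', c', d']"
      and p: "is_partition a" "is_partition b" "is_partition c" "is_partition d"
        "is_partition a'" "is_partition b'" "is_partition c'" "is_partition d'"
      unfolding mem_Collect_eq cylindric_partitions_1100 by blast
    have x: "chain_x (part a) (part b) (part c) (part d) = chain_x (part a') (part b') (part c') (part d')"
      and y: "chain_y (part a) (part b) (part c) (part d) = chain_y (part a') (part b') (part c') (part d')"
      using e unfolding L to_chains_simp by simp_all
    show "\<Lambda> = \<Lambda>'"
      unfolding L using chain_inj[OF x y] p by (simp add: part_inj)
  qed
  moreover have "to_chains \<Lambda> \<in> ?B" if L: "\<Lambda> \<in> ?A" for \<Lambda>
  proof -
    obtain a b c d where abcd: "\<Lambda> = [a, b, c, d]"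
      and i: "interlaced (chain_x (part a) (part b) (part c) (part d)) (chain_y (part a) (part b) (part c) (part d))" (is "interlaced ?x ?y")
      using L unfolding cylindric_partitions_1100 by blast
    define K where "K = length a + length b + length c + length d"
    have z: "\<forall>j\<ge>2 * K. part a j = 0 \<and> part b j = 0 \<and> part c j = 0 \<and> part d j = 0"
      by (auto simp: K_def intro!: part_zero)
    have t: "support_sum ?x + support_sum ?y = s"
      using L by (simp add: support_sum_chain[OF z] support_sum_part abcd cyl_size_def)
    have z': "\<forall>j\<ge>4 * K. ?x j = 0" "\<forall>j\<ge>4 * K. ?y j = 0"
      using chain_zero[OF z] by blast+
    have "?x j = 0" "?y j = 0" if "s \<le> j" for j
      using i t that
      by (auto intro!: decseq_support_sum_zero[OF _ z'(1)] decseq_support_sum_zero[OF _ z'(2)] simp: interlaced_def)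
    then show ?thesis
      using assms i t unfolding abcd to_chains_simp by (auto simp: pairs_of_weight_def chain_pairs_def)
  qed
  moreover have "\<exists>\<Lambda>\<in>?A. p = to_chains \<Lambda>" if B: "p \<in> ?B" for p
  proof -
    obtain a b c d where p: "p = (chain_x a b c d, chain_y a b c d)"
      by (metis chain_surj surj_pair)
    have i: "interlaced (chain_x a b c d) (chain_y a b c d)"
      using B by (auto simp: p pairs_of_weight_def chain_pairs_def)
    have zx: "chain_x a b c d j = 0" "chain_y a b c d j = 0" if "n \<le> j" for j
      using B that by (auto simp: p pairs_of_weight_def chain_pairs_def)
    \<comment> \<open>These places lie beyond the bound, so every row has a zero and
      \<open>part_surj\<close> applies.\<close>
    have "chain_x a b c d (4 * n) = b (2 * n)" "chain_x a b c d (4 * n + 1) = c (2 * n)"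
      "chain_x a b c d (4 * n + 2) = d (2 * n)" "chain_y a b c d (4 * n) = a (2 * n)"
      by (simp_all only: chain_x_def chain_y_def deal4_simps)
    then have "a (2 * n) = 0" "b (2 * n) = 0" "c (2 * n) = 0" "d (2 * n) = 0"
      by (simp_all add: zx)
    moreover have "decseq a" "decseq b" "decseq c" "decseq d"
      using i unfolding interlaced_chain_iff by blast+
    ultimately obtain a' b' c' d' where
      q: "is_partition a'" "is_partition b'" "is_partition c'" "is_partition d'" and
      e: "a = part a'" "b = part b'" "c = part c'" "d = part d'"
      by (metis part_surj)
    have p': "p = to_chains [a', b', c', d']"
      by (simp add: p to_chains_simp e)
    have z: "\<forall>j\<ge>2 * (length a' + length b' + length c' + length d'). a j = 0 \<and> b j = 0 \<and> c j = 0 \<and> d j = 0"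
      unfolding e by (auto intro!: part_zero)
    have "support_sum a + support_sum b + support_sum c + support_sum d = s"
      using B support_sum_chain[OF z] by (simp add: p pairs_of_weight_def)
    then have "cyl_size [a', b', c', d'] = s"
      by (simp add: cyl_size_def e support_sum_part)
    then show ?thesis
      using p' q i unfolding e cylindric_partitions_1100 by blast
  qed
  ultimately show ?thesis
    unfolding bij_betw_def by blast
qed

section \<open>Comparison of the two sides\<close>

lemma cylindric_count_product:
  defines "c \<equiv> Abs_fps (\<lambda>s. of_nat (card {\<Lambda> \<in> cylindric_partitions [1, 1, 0, 0]. cyl_size \<Lambda> = s})) :: 'a::field fps"
  shows "c * (qpoch_inf fps_X fps_X)\<^sup>2 = qpoch_inf (fps_X\<^sup>2) (fps_X\<^sup>2)"
proof (rule fps_eqI_cong)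
  fix n
  let ?P = "qpoch_inf fps_X fps_X :: 'a fps"
  have "fps_cong n c (pair_gf (int n) (int n))"
    unfolding fps_cong_iff_nth c_def pair_gf_def
  proof (intro allI impI)
    fix k assume "k < n"
    then show "Abs_fps (\<lambda>s. of_nat (card {\<Lambda> \<in> cylindric_partitions [1, 1, 0, 0]. cyl_size \<Lambda> = s})) $ k =
        (Abs_fps (\<lambda>s. of_nat (card (pairs_of_weight (int n) (int n) s))) $ k :: 'a)"
      by (simp only: fps_nth_Abs_fps bij_betw_same_card[OF bij_betw_to_chains[OF less_imp_le]])
  qed
  \<comment> \<open>The cutoff \<open>Suc n\<close> exceeds \<open>n\<close>, as
    \<open>pair_gf_eq_reflected_sum\<close> demands.\<close>
  then have "fps_cong n (c * ?P\<^sup>2) (reflected_sum (int (Suc n)) (int n) (int n) * ?P\<^sup>2)"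
    unfolding pair_gf_eq_reflected_sum[OF lessI] by (rule fps_cong_mult) simp
  then have "fps_cong n (c * ?P\<^sup>2) (pentagonal_sum (int (Suc n)))"
    by (rule fps_cong_trans[OF _ fps_cong_reflected_sum])
  then show "fps_cong n (c * ?P\<^sup>2) (qpoch_inf (fps_X\<^sup>2) (fps_X\<^sup>2))"
    by (rule fps_cong_trans[OF _ fps_cong_mono[OF fps_cong_pentagonal_sum]]) simp
qed

theorem theorem5p6:
  defines "q \<equiv> (fps_X :: rat fps)"
  shows "((\<lambda>\<Lambda>. q ^ cyl_size \<Lambda>) has_sum
           ((\<Sum>n. q ^ (n\<^sup>2) / qpoch (q\<^sup>2) (q\<^sup>2) n) *
            (qpoch_inf (- (q\<^sup>2)) (q\<^sup>2) / qpoch_inf q q)))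
         (cylindric_partitions [1, 1, 0, 0])"
    (is "(_ has_sum ?E * (?D / ?P)) ?C")
proof -
  define c where "c = (Abs_fps (\<lambda>s. of_nat (card {\<Lambda> \<in> ?C. cyl_size \<Lambda> = s})) :: rat fps)"
  have P0: "?P $ 0 = 1"
    by (rule qpoch_inf_nth_0) (simp_all add: q_def)
  then have "?P \<noteq> 0"
    by auto
  \<comment> \<open>Both sides equal \<open>qpoch_inf (q\<^sup>2) (q\<^sup>2)\<close>; one factor
    \<open>?P\<close> is then cancelled.\<close>
  have "c * ?P * ?P = ?E * ?D * ?P"
    using cylindric_count_product[where ?'a=rat] product_side[where ?'a=rat]
    by (simp add: c_def q_def power2_eq_square mult.assoc)
  then have "c * ?P = ?E * ?D"
    using \<open>?P \<noteq> 0\<close> by simp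
  then have c: "?E * (?D / ?P) = c"
  proof -
    have "?E * (?D / ?P) = ?E * ?D * inverse ?P"
      using P0 by (simp add: fps_divide_unit mult.assoc)
    also have "\<dots> = c * (?P * inverse ?P)"
      unfolding \<open>c * ?P = ?E * ?D\<close>[symmetric] by (rule mult.assoc)
    also have "?P * inverse ?P = 1"
      by (rule inverse_mult_eq_1') (simp add: P0)
    finally show ?thesis by simp
  qed
  have supp: "{\<Lambda> \<in> ?C. (q ^ cyl_size \<Lambda>) $ n \<noteq> 0} = {\<Lambda> \<in> ?C. cyl_size \<Lambda> = n}" for n
    by (auto simp: q_def)
  show ?thesis
    unfolding c
  proof (rule has_sum_fpsI)
    fix n
    \<comment> \<open>Coefficientwise summation needs finitely many cylindric partitions of each
      size; the bijection provides this.\<close>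
    show "finite {\<Lambda> \<in> ?C. (q ^ cyl_size \<Lambda>) $ n \<noteq> 0}"
      unfolding supp using bij_betw_finite[OF bij_betw_to_chains[OF order_refl]] finite_pairs_of_weight
      by blast
    show "c $ n = (\<Sum>\<Lambda> | \<Lambda> \<in> ?C \<and> (q ^ cyl_size \<Lambda>) $ n \<noteq> 0. (q ^ cyl_size \<Lambda>) $ n)"
      unfolding supp by (simp add: c_def q_def)
  qed
qed

end
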